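(* Let $\mathcal{S}$ be a finite-dimensional compact convex set with $\mathrm{Aff}(\mathcal{S}) = \mathbb{R}^n$, $n < \infty$. Let $G$ denote the group of bijective affine transformations of $\mathcal{S}$ (onto itself). Then $\mathcal{S}$ is affine isomorphic to the $n$-dimensional unit ball if and only if the following two conditions are satisfied: (1) The diagonal action of $G$ on the set of pairs $(s_1,s_2)$ of distinguishable extreme points $s_1,s_2 \in \mathcal{S}_{\mathrm{ext}}$ is transitive. (2) The set $\mathcal{S}$ has $2$-spectrality.
   Context: $\mathrm{Aff}(\mathcal{S})$ denotes the affine hull of $\mathcal{S}$ and $\mathcal{S}_{\mathrm{ext}}$ the set of extreme points of $\mathcal{S}$. A group $G$ acts transitively on a set $X$ if for any $x_1,x_2\in X$ there is $g\in G$ with $g\cdot x_1=x_2$. The diagonal action is $g\cdot(s_1,s_2)=(g(s_1),g(s_2))$, on ordered pairs. Two convex sets are affine isomorphic if there is an affine bijection between them. The unit ball is the closed solid ball. Points $s_1,\dots,s_m$ of a convex subset $\mathcal{S}$ of a real vector space are distinguishable if there exist $m$ affine functionals $e_i:\mathcal{S}\to\mathbb{R}$ ($1\le i\le m$) such that $e_i\ge 0$ on $\mathcal{S}$, $\sum_{i=1}^m e_i = 1$ (constantly on $\mathcal{S}$) and $e_i(s_i)=1$ for every $1\le i\le m$. A convex set $\mathcal{S}$ has $k$-spectrality if each $s\in\mathcal{S}$ admits a decomposition $s=\sum_{j=1}^{\ell}\lambda_j s_j$ with $1\le \ell\le k$ into distinguishable extreme points $s_1,\dots,s_\ell\in\mathcal{S}_{\mathrm{ext}}$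 such that $\sum_{j=1}^{\ell}\lambda_j=1$ and $\lambda_j\ge 0$ for every $j$. *)

theory Defs
  imports "HOL-Analysis.Analysis" "HOL-Algebra.Group_Action"
begin

text \<open>Affine maps on a convex set, i.e. maps preserving binary convex combinations.
  Values outside the set are irrelevant.\<close>

definition affine_on :: "'a::real_vector set \<Rightarrow> ('a \<Rightarrow> 'b::real_vector) \<Rightarrow> bool" where
  "affine_on S f \<longleftrightarrow>
    (\<forall>x\<in>S. \<forall>y\<in>S. \<forall>u\<ge>0. \<forall>v\<ge>0. u + v = 1 \<longrightarrow> f (u *\<^sub>R x + v *\<^sub>R y) = u *\<^sub>R f x + v *\<^sub>R f y)"

definition affine_isomorphic :: "'a::real_vector set \<Rightarrow> 'b::real_vector set \<Rightarrow> bool" where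
  "affine_isomorphic S T \<longleftrightarrow> (\<exists>f. affine_on S f \<and> bij_betw f S T)"

text \<open>Maps in \<open>Bij S\<close> are extensional, so two elements of the group agree iff they agree on \<open>S\<close>.\<close>

definition AffGroup :: "'a::real_vector set \<Rightarrow> ('a \<Rightarrow> 'a) monoid" where
  "AffGroup S = BijGroup S \<lparr>carrier := {g \<in> Bij S. affine_on S g}\<rparr>"

definition extreme_points :: "'a::real_vector set \<Rightarrow> 'a set" where
  "extreme_points S = {x. x extreme_point_of S}"

definition distinguishable :: "'a::real_vector set \<Rightarrow> 'a list \<Rightarrow> bool" where
  "distinguishable S xs \<longleftrightarrow> set xs \<subseteq> S \<and>
    (\<exists>e :: nat \<Rightarrow> 'a \<Rightarrow> real.
      (\<forall>i<length xs. affine_on S (e i) \<and> (\<forall>x\<in>S. e i x \<ge> 0)) \<and>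
      (\<forall>x\<in>S. (\<Sum>i<length xs. e i x) = 1) \<and>
      (\<forall>i<length xs. e i (xs ! i) = 1))"

definition spectrality :: "nat \<Rightarrow> 'a::real_vector set \<Rightarrow> bool" where
  "spectrality k S \<longleftrightarrow>
    (\<forall>s\<in>S. \<exists>xs. \<exists>c :: nat \<Rightarrow> real.
      1 \<le> length xs \<and> length xs \<le> k \<and>
      set xs \<subseteq> extreme_points S \<and> distinguishable S xs \<and>
      (\<forall>j<length xs. c j \<ge> 0) \<and> (\<Sum>j<length xs. c j) = 1 \<and>
      s = (\<Sum>j<length xs. c j *\<^sub>R (xs ! j)))"

definition distinguishable_pairs :: "'a::real_vector set \<Rightarrow> ('a \<times> 'a) set" where
  "distinguishable_pairs S =
    {(s1, s2). s1 \<in> extreme_points S \<and> s2 \<in> extreme_points S \<and> distinguishable S [s1, s2]}"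

definition diagonal_action :: "'a::real_vector set \<Rightarrow> ('a \<Rightarrow> 'a) \<Rightarrow> 'a \<times> 'a \<Rightarrow> 'a \<times> 'a" where
  "diagonal_action S g = (\<lambda>(s1, s2) \<in> distinguishable_pairs S. (g s1, g s2))"

text \<open>The diagonal action really is a group action, so \<open>transitive_action\<close> only adds the
  usual transitivity condition.\<close>

lemma affine_onD:
  "\<lbrakk>affine_on S f; x \<in> S; y \<in> S; u \<ge> 0; v \<ge> 0; u + v = 1\<rbrakk>
    \<Longrightarrow> f (u *\<^sub>R x + v *\<^sub>R y) = u *\<^sub>R f x + v *\<^sub>R f y"
  by (auto simp: affine_on_def)

lemma affine_on_compose:
  assumes "affine_on S f" "f \<in> S \<rightarrow> T" "affine_on T g"
  shows "affine_on S (g \<circ> f)"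
  using assms unfolding affine_on_def by (auto simp: Pi_iff)

lemma affine_on_cong:
  assumes "convex S" "\<And>x. x \<in> S \<Longrightarrow> f x = g x" "affine_on S f"
  shows "affine_on S g"
  unfolding affine_on_def
proof (intro ballI allI impI)
  fix x y and u v :: real
  assume *: "x \<in> S" "y \<in> S" "0 \<le> u" "0 \<le> v" "u + v = 1"
  then have "u *\<^sub>R x + v *\<^sub>R y \<in> S" using assms(1) by (auto intro: convexD)
  with * affine_onD[OF assms(3) *] show "g (u *\<^sub>R x + v *\<^sub>R y) = u *\<^sub>R g x + v *\<^sub>R g y"
    by (simp add: assms(2))
qed

lemma affine_on_inv_into:
  assumes S: "convex S" and f: "affine_on S f" "bij_betw f S T"
  shows "affine_on T (inv_into S f)"
  unfolding affine_on_def
proof (intro ballI allI impI)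
  fix x y and u v :: real
  assume *: "x \<in> T" "y \<in> T" "0 \<le> u" "0 \<le> v" "u + v = 1"
  let ?h = "inv_into S f"
  have h: "?h x \<in> S" "?h y \<in> S" "f (?h x) = x" "f (?h y) = y"
    using * f(2) by (auto simp: bij_betw_def inv_into_into f_inv_into_f)
  then have "u *\<^sub>R ?h x + v *\<^sub>R ?h y \<in> S" using S * by (auto intro: convexD)
  moreover have "f (u *\<^sub>R ?h x + v *\<^sub>R ?h y) = u *\<^sub>R x + v *\<^sub>R y"
    using affine_onD[OF f(1) h(1,2) *(3-5)] h by simp
  ultimately show "?h (u *\<^sub>R x + v *\<^sub>R y) = u *\<^sub>R ?h x + v *\<^sub>R ?h y"
    using f(2) by (metis bij_betw_inv_into_left)
qed

lemma group_AffGroup: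
  assumes "convex S"
  shows "group (AffGroup S)" "subgroup (carrier (AffGroup S)) (BijGroup S)"
proof -
  interpret B: group "BijGroup S" by (rule group_BijGroup)
  let ?A = "{g \<in> Bij S. affine_on S g}"
  have "subgroup ?A (BijGroup S)"
  proof (rule B.subgroupI)
    show "?A \<subseteq> carrier (BijGroup S)" by (auto simp: BijGroup_def)
    have "affine_on S (\<lambda>x\<in>S. x)"
      by (rule affine_on_cong[OF assms, of "\<lambda>x. x"]) (auto simp: affine_on_def)
    then show "?A \<noteq> {}" using id_Bij by blast
  next
    fix g assume g: "g \<in> ?A"
    then have "affine_on S (inv_into S g)"
      by (auto intro!: affine_on_inv_into assms simp: Bij_def)
    then have "affine_on S (\<lambda>x\<in>S. inv_into S g x)"
      using assms by (rule_tac affine_on_cong) auto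
    moreover have "inv\<^bsub>BijGroup S\<^esub> g = (\<lambda>x\<in>S. inv_into S g x)"
      using g by (simp add: inv_BijGroup)
    ultimately show "inv\<^bsub>BijGroup S\<^esub> g \<in> ?A"
      using g by (simp add: restrict_inv_into_Bij)
  next
    fix g h assume gh: "g \<in> ?A" "h \<in> ?A"
    then have "affine_on S (g \<circ> h)"
      by (auto intro!: affine_on_compose[where T = S] dest: Bij_imp_funcset)
    then have "affine_on S (compose S g h)"
      using assms by (rule_tac affine_on_cong) (auto simp: compose_def)
    then show "g \<otimes>\<^bsub>BijGroup S\<^esub> h \<in> ?A"
      using gh by (simp add: BijGroup_def compose_Bij)
  qed
  then show "subgroup (carrier (AffGroup S)) (BijGroup S)" "group (AffGroup S)"
    using B.subgroup_imp_group by (auto simp: AffGroup_def)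
qed

lemma extreme_point_image:
  assumes S: "convex S" and g: "affine_on S g" "bij_betw g S S" and x: "x extreme_point_of S"
  shows "g x extreme_point_of S"
  unfolding extreme_point_of_def
proof (intro conjI ballI notI)
  show "g x \<in> S" using g x by (auto simp: extreme_point_of_def bij_betw_def)
next
  fix a b assume ab: "a \<in> S" "b \<in> S" "g x \<in> open_segment a b"
  then obtain u where u: "a \<noteq> b" "0 < u" "u < 1" "g x = (1 - u) *\<^sub>R a + u *\<^sub>R b"
    by (auto simp: in_segment)
  let ?h = "inv_into S g"
  have h: "affine_on S ?h" using affine_on_inv_into[OF S g] .
  have "?h (g x) = x" using g x by (auto simp: extreme_point_of_def bij_betw_inv_into_left)
  then have "x = (1 - u) *\<^sub>R ?h a + u *\<^sub>R ?h b"
    using affine_onD[OF h ab(1,2), of "1 - u" u] u by simp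
  moreover have "?h a \<in> S" "?h b \<in> S" "?h a \<noteq> ?h b"
    using ab u g(2) by (auto simp: bij_betw_def inv_into_into inv_into_injective)
  ultimately have "x \<in> open_segment (?h a) (?h b)" using u by (auto simp: in_segment)
  with x \<open>?h a \<in> S\<close> \<open>?h b \<in> S\<close> show False by (auto simp: extreme_point_of_def)
qed

lemma distinguishable_image:
  assumes S: "convex S" and g: "affine_on S g" "bij_betw g S S" and xs: "distinguishable S xs"
  shows "distinguishable S (map g xs)"
proof -
  let ?h = "inv_into S g"
  have h: "affine_on S ?h" using affine_on_inv_into[OF S g] .
  have hS: "?h x \<in> S" if "x \<in> S" for x using that g(2) by (auto simp: bij_betw_def inv_into_into)
  have hg: "?h (g x) = x" if "x \<in> S" for x using that g(2) by (simp add: bij_betw_inv_into_left)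
  from xs obtain e :: "nat \<Rightarrow> 'a \<Rightarrow> real" where sub: "set xs \<subseteq> S"
    and e: "\<forall>i<length xs. affine_on S (e i) \<and> (\<forall>x\<in>S. e i x \<ge> 0)"
      "\<forall>x\<in>S. (\<Sum>i<length xs. e i x) = 1" "\<forall>i<length xs. e i (xs ! i) = 1"
    unfolding distinguishable_def by blast
  have "set (map g xs) \<subseteq> S" using sub g(2) by (auto simp: bij_betw_def)
  moreover have "xs ! i \<in> S" if "i < length xs" for i using that sub by auto
  ultimately show ?thesis
    unfolding distinguishable_def using e h hS hg
    by (intro conjI exI[of _ "\<lambda>i. e i \<circ> ?h"]) (auto intro!: affine_on_compose[of S ?h S])
qed

lemma distinguishable_pairs_image:
  assumes "convex S" "g \<in> carrier (AffGroup S)" "(s1, s2) \<in> distinguishable_pairs S"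
  shows "(g s1, g s2) \<in> distinguishable_pairs S"
  using assms distinguishable_image[of S g "[s1, s2]"] extreme_point_image[of S g]
  by (auto simp: distinguishable_pairs_def AffGroup_def Bij_def extreme_points_def)

lemma distinguishable_pairs_subset: "distinguishable_pairs S \<subseteq> S \<times> S"
  by (auto simp: distinguishable_pairs_def distinguishable_def)

lemma group_action_diagonal:
  assumes S: "convex S"
  shows "group_action (AffGroup S) (distinguishable_pairs S) (diagonal_action S)"
proof -
  let ?P = "distinguishable_pairs S" and ?G = "AffGroup S"
  interpret G: group ?G using group_AffGroup[OF S] by simp
  have one: "\<one>\<^bsub>?G\<^esub> = (\<lambda>x\<in>S. x)" by (simp add: AffGroup_def BijGroup_def)
  have mult: "g \<otimes>\<^bsub>?G\<^esub> h = compose S g h" if "g \<in> carrier ?G" "h \<in> carrier ?G" for g h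
    using that by (simp add: AffGroup_def BijGroup_def)
  have P: "a \<in> S" "b \<in> S" if "(a, b) \<in> ?P" for a b
    using that distinguishable_pairs_subset by blast+
  have into: "diagonal_action S g \<in> ?P \<rightarrow> ?P" if "g \<in> carrier ?G" for g
    using distinguishable_pairs_image[OF S that] by (auto simp: diagonal_action_def)
  have comp: "diagonal_action S (g \<otimes>\<^bsub>?G\<^esub> h) = compose ?P (diagonal_action S g) (diagonal_action S h)"
    if "g \<in> carrier ?G" "h \<in> carrier ?G" for g h
    using distinguishable_pairs_image[OF S that(2)] P
    by (auto simp: fun_eq_iff diagonal_action_def mult[OF that] compose_def)
  have id: "diagonal_action S \<one>\<^bsub>?G\<^esub> = (\<lambda>p\<in>?P. p)"
    using P by (auto simp: fun_eq_iff diagonal_action_def one)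
  have bij: "diagonal_action S g \<in> Bij ?P" if g: "g \<in> carrier ?G" for g
  proof -
    let ?i = "inv\<^bsub>?G\<^esub> g"
    have i: "?i \<in> carrier ?G" using g by simp
    have "compose ?P (diagonal_action S ?i) (diagonal_action S g) = (\<lambda>p\<in>?P. p)"
      "compose ?P (diagonal_action S g) (diagonal_action S ?i) = (\<lambda>p\<in>?P. p)"
      using comp[OF i g] comp[OF g i] id g by auto
    then have "\<And>p. p \<in> ?P \<Longrightarrow> diagonal_action S ?i (diagonal_action S g p) = p"
      "\<And>p. p \<in> ?P \<Longrightarrow> diagonal_action S g (diagonal_action S ?i p) = p"
      by (metis compose_eq restrict_apply')+
    then have "bij_betw (diagonal_action S g) ?P ?P"
      using into[OF g] into[OF i] by (intro bij_betwI[where g = "diagonal_action S ?i"]) auto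
    moreover have "diagonal_action S g \<in> extensional ?P"
      by (simp add: diagonal_action_def)
    ultimately show ?thesis by (simp add: Bij_def)
  qed
  have "diagonal_action S \<in> hom ?G (BijGroup ?P)"
    using bij comp by (auto simp: hom_def BijGroup_def)
  then show ?thesis
    by (intro group_action.intro group_hom.intro group_hom_axioms.intro
        group_BijGroup G.group_axioms)
qed

lemma transitive_action_diagonal_iff:
  assumes S: "convex S"
  shows "transitive_action (AffGroup S) (distinguishable_pairs S) (diagonal_action S) \<longleftrightarrow>
    (\<forall>(s1, s2) \<in> distinguishable_pairs S. \<forall>(t1, t2) \<in> distinguishable_pairs S.
      \<exists>g. affine_on S g \<and> bij_betw g S S \<and> g s1 = t1 \<and> g s2 = t2)"
    (is "?L \<longleftrightarrow> ?R")
proof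
  assume ?L
  then interpret transitive_action "AffGroup S" "distinguishable_pairs S" "diagonal_action S" .
  show ?R
  proof clarify
    fix s1 s2 t1 t2
    assume st: "(s1, s2) \<in> distinguishable_pairs S" "(t1, t2) \<in> distinguishable_pairs S"
    from unique_orbit[OF this] obtain g where "g \<in> carrier (AffGroup S)"
      "diagonal_action S g (s1, s2) = (t1, t2)" by blast
    then show "\<exists>g. affine_on S g \<and> bij_betw g S S \<and> g s1 = t1 \<and> g s2 = t2"
      using st by (auto simp: diagonal_action_def AffGroup_def Bij_def)
  qed
next
  assume R: ?R
  have "\<exists>g\<in>carrier (AffGroup S). diagonal_action S g p = q"
    if pq: "p \<in> distinguishable_pairs S" "q \<in> distinguishable_pairs S" for p q
  proof -
    obtain s1 s2 t1 t2 where [simp]: "p = (s1, s2)" "q = (t1, t2)" by (cases p, cases q) auto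
    from R pq obtain g where g: "affine_on S g" "bij_betw g S S" "g s1 = t1" "g s2 = t2"
      by fastforce
    have "restrict g S \<in> carrier (AffGroup S)"
      using g affine_on_cong[OF S, of g "restrict g S"] by (simp add: AffGroup_def Bij_def)
    moreover have "diagonal_action S (restrict g S) p = q"
      using pq g distinguishable_pairs_subset by (fastforce simp: diagonal_action_def)
    ultimately show ?thesis by blast
  qed
  then show ?L
    by (intro transitive_action.intro transitive_action_axioms.intro group_action_diagonal[OF S])
qed

end

theory Submission
  imports Defs
begin

text \<open>Both conditions are invariant under affine bijections and easy for the ball, whose
  distinguishable pairs are exactly the pairs of antipodal unit vectors. Conversely, the affine
  automorphisms of \<open>S\<close> have a common fixed point \<open>c\<close> in the relative interior. By spectrality
  \<open>c\<close> lies between some distinguishable pair \<open>(s, t)\<close>; applying an automorphism that swaps \<open>s\<close>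
  and \<open>t\<close> shows that \<open>c\<close> is their midpoint, and by transitivity \<open>c\<close> is the midpoint of every
  distinguishable pair. The automorphisms also preserve a Euclidean norm centred at \<open>c\<close>, for
  which all these pairs lie on one sphere. Since by spectrality every non-extreme point lies on
  a chord between such a pair, \<open>S\<close> is the ball bounded by this sphere, i.e. an ellipsoid.

  Both the fixed point and the invariant norm come from one averaging argument without Haar
  measure: on a compact convex set acted on by the group, the supremum of a quadratic function
  over the orbit of a point is an invariant, uniformly convex function, so its unique minimiser
  is a fixed point.\<close>

subsection \<open>Fixed points\<close>

text \<open>\<open>H\<close> stands for a squared Hilbert norm, and \<open>F\<close> in the proof is
  its supremum over an orbit. The bound in \<open>separated\<close> is uniform in \<open>g\<close>,
  so by the parallelogram identity the midpoint of two distinct minimisers would have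
  \<open>F\<close> below the minimum by a fixed amount.\<close>

lemma common_fixed_point:
  fixes K :: "'b::real_normed_vector set" and H :: "'b \<Rightarrow> real"
  assumes K: "compact K" "convex K" "K \<noteq> {}"
    and H: "continuous_on UNIV H"
    and parallelogram: "\<And>x y. H ((1/2) *\<^sub>R (x + y)) = (H x + H y) / 2 - H (x - y) / 4"
    and maps: "\<And>g x. \<lbrakk>g \<in> G; x \<in> K\<rbrakk> \<Longrightarrow> g x \<in> K"
    and cont: "\<And>g. g \<in> G \<Longrightarrow> continuous_on K g"
    and midpoint: "\<And>g x y. \<lbrakk>g \<in> G; x \<in> K; y \<in> K\<rbrakk> \<Longrightarrow>
      g ((1/2) *\<^sub>R (x + y)) = (1/2) *\<^sub>R (g x + g y)"
    and comp: "\<And>g h. \<lbrakk>g \<in> G; h \<in> G\<rbrakk> \<Longrightarrow> \<exists>k\<in>G. \<forall>x\<in>K. k x = g (h x)"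
    and separated: "\<And>x y. \<lbrakk>x \<in> K; y \<in> K; x \<noteq> y\<rbrakk> \<Longrightarrow> \<exists>d>0. \<forall>g\<in>G. d \<le> H (g x - g y)"
  shows "\<exists>x\<in>K. \<forall>g\<in>G. g x = x"
proof (cases "G = {}")
  case True
  then show ?thesis using K(3) by auto
next
  case False
  have "compact (H ` K)"
    using H K(1) by (intro compact_continuous_image) (auto intro: continuous_on_subset)
  then have "bounded (H ` K)" by (rule compact_imp_bounded)
  then obtain C where C: "\<And>x. x \<in> K \<Longrightarrow> \<bar>H x\<bar> \<le> C" by (auto simp: bounded_iff)
  define F where "F x = (SUP g\<in>G. H (g x))" for x
  have F_ge: "H (g x) \<le> F x" if "g \<in> G" "x \<in> K" for g x
    unfolding F_def using that C[OF maps]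
      by (intro cSUP_upper bdd_aboveI[of _ C]) (force simp: abs_le_iff)+
  have F_le: "F x \<le> b" if "\<And>g. g \<in> G \<Longrightarrow> H (g x) \<le> b" for x b
    unfolding F_def using that False by (intro cSUP_least) auto
  obtain g0 where g0: "g0 \<in> G" using False by auto
  have bdd: "bdd_below (F ` K)"
  proof (rule bdd_belowI2)
    fix x assume x: "x \<in> K"
    show "-C \<le> F x" using F_ge[OF g0 x] C[OF maps[OF g0 x]] by linarith
  qed
  define m where "m = (INF x\<in>K. F x)"
  have m_le: "m \<le> F x" if "x \<in> K" for x unfolding m_def using bdd that by (rule cINF_lower)
  have "\<exists>x\<in>K. F x < m + inverse (real (Suc n))" for n
    using cINF_less_iff[OF K(3) bdd, of "m + inverse (real (Suc n))"] unfolding m_def by simp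
  then obtain X where X: "\<And>n. X n \<in> K" "\<And>n. F (X n) < m + inverse (real (Suc n))" by metis
  obtain l r where l: "l \<in> K" and r: "strict_mono r" "(X \<circ> r) \<longlonglongrightarrow> l"
    using K(1) X(1) unfolding compact_def by metis
  \<comment> \<open>As a supremum of continuous functions, \<open>F\<close> is only lower
    semicontinuous; the limit is taken for each \<open>g\<close> separately.\<close>
  have "F l \<le> m"
  proof (rule F_le)
    fix g assume g: "g \<in> G"
    have "(\<lambda>n. g ((X \<circ> r) n)) \<longlonglongrightarrow> g l"
      using cont[OF g] l r(2) X(1) unfolding continuous_on_sequentially by (auto simp: o_def)
    moreover have "isCont H (g l)" using H by (simp add: continuous_on_eq_continuous_at)
    ultimately have 1: "(\<lambda>n. H (g (X (r n)))) \<longlonglongrightarrow> H (g l)"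
      by (auto intro: isCont_tendsto_compose)
    have "(\<lambda>n. inverse (real (Suc n))) \<longlonglongrightarrow> 0" by (rule LIMSEQ_inverse_real_of_nat)
    from LIMSEQ_subseq_LIMSEQ[OF this r(1)]
    have 2: "(\<lambda>n. m + inverse (real (Suc (r n)))) \<longlonglongrightarrow> m + 0"
      by (intro tendsto_intros) (simp add: o_def)
    have "H (g (X (r n))) \<le> m + inverse (real (Suc (r n)))" for n
      using F_ge[OF g X(1)] X(2)[of "r n"] by (meson less_imp_le order_trans)
    then show "H (g l) \<le> m" using LIMSEQ_le[OF 1 2] by auto
  qed
  have "h l = l" if h: "h \<in> G" for h
  proof (rule ccontr)
    assume ne: "h l \<noteq> l"
    have hl: "h l \<in> K" using maps h l .
    \<comment> \<open>The orbit of \<open>h l\<close> is contained in the orbit of \<open>l\<close>,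
      so \<open>h l\<close> is a minimiser too.\<close>
    have "F (h l) \<le> m"
    proof (rule F_le)
      fix g assume "g \<in> G"
      with comp h l obtain k where "k \<in> G" "k l = g (h l)" by blast
      then show "H (g (h l)) \<le> m" using F_ge[of k l] l \<open>F l \<le> m\<close> by simp
    qed
    obtain d where d: "d > 0" "\<And>g. g \<in> G \<Longrightarrow> d \<le> H (g (h l) - g l)"
      using separated[OF hl l ne] by blast
    let ?y = "(1/2) *\<^sub>R (h l + l)"
    have y: "?y \<in> K" using convexD[OF K(2) hl l, of "1/2" "1/2"] by (simp add: scaleR_add_right)
    have "F ?y \<le> m - d / 4"
    proof (rule F_le)
      fix g assume g: "g \<in> G"
      show "H (g ?y) \<le> m - d / 4"
        unfolding midpoint[OF g hl l] parallelogram
        using d(2)[OF g] order_trans[OF F_ge[OF g l] \<open>F l \<le> m\<close>]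
          order_trans[OF F_ge[OF g hl] \<open>F (h l) \<le> m\<close>] by (simp add: field_simps)
    qed
    then show False using m_le[OF y] d(1) by linarith
  qed
  then show ?thesis using l by blast
qed

section \<open>Affine automorphisms of a compact convex set\<close>

text \<open>Elements of \<open>AffGroup S\<close> without extensionality: values outside
  \<open>S\<close> stay free, so composition and inverse are plain \<open>\<circ>\<close> and
  \<open>inv_into\<close>.\<close>

definition automorphism :: "'a::real_vector set \<Rightarrow> ('a \<Rightarrow> 'a) \<Rightarrow> bool" where
  "automorphism S g \<longleftrightarrow> affine_on S g \<and> bij_betw g S S"

lemma automorphismD:
  assumes "automorphism S g"
  shows "affine_on S g" "bij_betw g S S" "x \<in> S \<Longrightarrow> g x \<in> S"
  using assms by (auto simp: automorphism_def bij_betw_def)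

lemma automorphism_inv_into:
  assumes "convex S" "automorphism S g"
  shows "automorphism S (inv_into S g)"
  using assms affine_on_inv_into[of S g S] bij_betw_inv_into[of g S S]
  by (auto simp: automorphism_def)

lemma automorphism_compose:
  assumes "automorphism S g" "automorphism S h"
  shows "automorphism S (g \<circ> h)"
  using assms affine_on_compose[of S h S g] bij_betw_trans[of h S S g S]
  by (auto simp: automorphism_def bij_betw_def)

text \<open>The Lipschitz constant is a diameter bound over the radius of a relative ball in
  \<open>S\<close>: a segment of that length and parallel to \<open>x - y\<close> fits into
  \<open>S\<close> at \<open>z\<close>, and its image is no longer than the diameter.\<close>

lemma automorphisms_equicontinuous:
  fixes S :: "'a::euclidean_space set"
  assumes "bounded S" "convex S" "S \<noteq> {}"
  obtains C where "C > 0"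
    "\<And>g x y. \<lbrakk>automorphism S g; x \<in> S; y \<in> S\<rbrakk> \<Longrightarrow> norm (g x - g y) \<le> C * norm (x - y)"
proof -
  obtain z where "z \<in> rel_interior S" using rel_interior_eq_empty assms by blast
  then obtain r where z: "z \<in> S" and r: "r > 0" "cball z r \<inter> affine hull S \<subseteq> S"
    by (auto simp: mem_rel_interior_cball)
  obtain D where D: "D > 0" "\<And>x y. x \<in> S \<Longrightarrow> y \<in> S \<Longrightarrow> norm (x - y) \<le> D"
    using assms(1) unfolding bounded_two_points
    by (metis dist_norm less_eq_real_def linorder_not_less order_trans zero_less_one)
  have "norm (g x - g y) \<le> D / r * norm (x - y)"
    if g: "automorphism S g" and xy: "x \<in> S" "y \<in> S" for g x y
  proof (cases "x = y")
    case False
    define s where "s = r / norm (x - y)"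
    have s: "s > 0" using False r by (simp add: s_def)
    define a where "a = z + s *\<^sub>R (x - y)"
    have "a \<in> affine hull S" unfolding a_def
      using mem_affine_3_minus[OF affine_affine_hull, of z S x y s] z xy by (simp add: hull_inc)
    moreover have "norm (s *\<^sub>R (x - y)) = r" using False r by (simp add: s_def)
    then have "a \<in> cball z r" by (simp add: a_def dist_norm)
    ultimately have a: "a \<in> S" using r(2) by blast
    have g': "g ((1/(1+s)) *\<^sub>R p + (s/(1+s)) *\<^sub>R q) = (1/(1+s)) *\<^sub>R g p + (s/(1+s)) *\<^sub>R g q"
      if "p \<in> S" "q \<in> S" for p q
      using affine_onD[OF automorphismD(1)[OF g] that, of "1/(1+s)" "s/(1+s)"] s
      by (simp add: add_divide_distrib[symmetric])
    \<comment> \<open>\<open>affine_on\<close> speaks only of convex combinations, so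
      \<open>a - z = s *\<^sub>R (x - y)\<close> is recast as the equality of two convex
      combinations of points of \<open>S\<close>.\<close>
    have "(1/(1+s)) *\<^sub>R a + (s/(1+s)) *\<^sub>R y = (1/(1+s)) *\<^sub>R z + (s/(1+s)) *\<^sub>R x"
      by (simp add: a_def algebra_simps)
    with g'[OF a xy(2)] g'[OF z xy(1)]
    have "(1/(1+s)) *\<^sub>R g a + (s/(1+s)) *\<^sub>R g y = (1/(1+s)) *\<^sub>R g z + (s/(1+s)) *\<^sub>R g x" by simp
    then have "(1+s) *\<^sub>R ((1/(1+s)) *\<^sub>R g a + (s/(1+s)) *\<^sub>R g y) = (1+s) *\<^sub>R ((1/(1+s)) *\<^sub>R g z + (s/(1+s)) *\<^sub>R g x)" by simp
    then have "g a + s *\<^sub>R g y = g z + s *\<^sub>R g x" using s by (simp add: scaleR_add_right)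
    then have "s *\<^sub>R (g x - g y) = g a - g z" by (simp add: algebra_simps)
    then have "s * norm (g x - g y) = norm (g a - g z)" using s
      by (metis abs_of_pos norm_scaleR)
    also have "\<dots> \<le> D" using D(2) automorphismD(3)[OF g] a z by blast
    finally show ?thesis using s r False by (simp add: s_def field_simps)
  qed simp
  moreover have "D / r > 0" using D(1) r(1) by simp
  ultimately show thesis using that by blast
qed

text \<open>The fixed-point argument for the squared norm is run on a compact invariant set
  \<open>K\<close> inside the relative interior, because on \<open>S\<close> it would not locate the
  fixed point. Separation comes from the common Lipschitz constant.\<close>

lemma automorphisms_common_fixed_point:
  fixes S :: "'a::euclidean_space set"
  assumes S: "compact S" "convex S" "S \<noteq> {}"
  obtains c where "c \<in> rel_interior S" "\<And>g. automorphism S g \<Longrightarrow> g c = c"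
proof -
  obtain C where C: "C > 0"
    "\<And>g x y. \<lbrakk>automorphism S g; x \<in> S; y \<in> S\<rbrakk> \<Longrightarrow> norm (g x - g y) \<le> C * norm (x - y)"
    using automorphisms_equicontinuous[OF compact_imp_bounded[OF S(1)] S(2,3)] by blast
  obtain z where "z \<in> rel_interior S" using rel_interior_eq_empty S by blast
  then obtain r where z: "z \<in> S" and r: "r > 0" "cball z r \<inter> affine hull S \<subseteq> S"
    by (auto simp: mem_rel_interior_cball)
  obtain D where D: "D > 0" "\<And>x y. x \<in> S \<Longrightarrow> y \<in> S \<Longrightarrow> norm (x - y) \<le> D"
    using compact_imp_bounded[OF S(1)] unfolding bounded_two_points
    by (metis dist_norm less_eq_real_def linorder_not_less order_trans zero_less_one)
  \<comment> \<open>With this ratio every displacement \<open>t *\<^sub>R (z - y)\<close> has norm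
    at most \<open>r\<close>, which puts \<open>z\<close> into \<open>K\<close>.\<close>
  define t where "t = r / D"
  have t: "t > 0" using r D by (simp add: t_def)
  \<comment> \<open>Membership in \<open>K\<close> is expressed by convex combinations within \<open>S\<close> alone, so it is preserved by
    automorphisms; it also forces points into the relative interior.\<close>
  define K where "K = {x \<in> S. \<forall>y\<in>S. (1 + t) *\<^sub>R x - t *\<^sub>R y \<in> S}"
  have "z \<in> K"
  proof -
    have "(1 + t) *\<^sub>R z - t *\<^sub>R y \<in> S" if y: "y \<in> S" for y
    proof -
      have "z + t *\<^sub>R (z - y) \<in> affine hull S"
        using mem_affine_3_minus[OF affine_affine_hull, of z S z y t] z y by (simp add: hull_inc)
      moreover have "norm (t *\<^sub>R (z - y)) \<le> r"
        using D(2)[OF z y] D(1) r(1) unfolding norm_scaleR by (simp add: t_def field_simps)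
      then have "z + t *\<^sub>R (z - y) \<in> cball z r" by (simp only: mem_cball dist_norm) simp
      ultimately have "z + t *\<^sub>R (z - y) \<in> S" using r(2) by blast
      then show ?thesis by (simp add: algebra_simps)
    qed
    then show ?thesis using z by (simp add: K_def)
  qed
  have "K = S \<inter> (\<Inter>y\<in>S. {x. (1 + t) *\<^sub>R x - t *\<^sub>R y \<in> S})" by (auto simp: K_def)
  moreover have "closed {x. (1 + t) *\<^sub>R x - t *\<^sub>R y \<in> S}" for y
    using continuous_closed_vimage[OF compact_imp_closed[OF S(1)], of "\<lambda>x. (1 + t) *\<^sub>R x - t *\<^sub>R y"]
    by (auto simp: vimage_def)
  ultimately have "compact K" using S(1) by (auto intro!: compact_Int_closed closed_INT)
  have "convex K"
    unfolding convex_def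
  proof (intro ballI allI impI)
    fix x y and u v :: real
    assume *: "x \<in> K" "y \<in> K" "0 \<le> u" "0 \<le> v" "u + v = 1"
    have "(1 + t) *\<^sub>R (u *\<^sub>R x + v *\<^sub>R y) - t *\<^sub>R w \<in> S" if "w \<in> S" for w
    proof -
      have "u *\<^sub>R ((1 + t) *\<^sub>R x - t *\<^sub>R w) + v *\<^sub>R ((1 + t) *\<^sub>R y - t *\<^sub>R w)
        = (1 + t) *\<^sub>R (u *\<^sub>R x + v *\<^sub>R y) - (u + v) *\<^sub>R (t *\<^sub>R w)"
        by (simp add: algebra_simps)
      then show ?thesis using * that convexD[OF S(2), of "(1 + t) *\<^sub>R x - t *\<^sub>R w"
        "(1 + t) *\<^sub>R y - t *\<^sub>R w" u v]
        by (simp add: K_def)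
    qed
    then show "u *\<^sub>R x + v *\<^sub>R y \<in> K" using * S(2) by (auto simp: K_def intro: convexD)
  qed
  have maps: "g x \<in> K" if g: "automorphism S g" and x: "x \<in> K" for g x
  proof -
    have "(1 + t) *\<^sub>R g x - t *\<^sub>R y \<in> S" if y: "y \<in> S" for y
    proof -
      obtain y' where y': "y' \<in> S" "y = g y'" using y automorphismD(2)[OF g]
        by (auto simp: bij_betw_def)
      let ?w = "(1 + t) *\<^sub>R x - t *\<^sub>R y'"
      have w: "?w \<in> S" using x y' by (simp add: K_def)
      \<comment> \<open>Solving the extrapolation for \<open>x\<close> gives a convex combination,
        to which \<open>affine_on\<close> applies.\<close>
      have "x = (1/(1+t)) *\<^sub>R ?w + (t/(1+t)) *\<^sub>R y'"
        using t by (simp add: algebra_simps) (simp flip: scaleR_left_distrib add_divide_distrib)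
      then have "g x = (1/(1+t)) *\<^sub>R g ?w + (t/(1+t)) *\<^sub>R g y'"
        using affine_onD[OF automorphismD(1)[OF g] w y'(1), of "1/(1+t)" "t/(1+t)"] t
        by (simp add: add_divide_distrib[symmetric])
      then have "(1 + t) *\<^sub>R g x - t *\<^sub>R y = g ?w" using t by (simp add: y' scaleR_add_right)
      then show ?thesis using automorphismD(3)[OF g w] by simp
    qed
    then show ?thesis using x automorphismD(3)[OF g] by (simp add: K_def)
  qed
  have "\<exists>c\<in>K. \<forall>g\<in>{g. automorphism S g}. g c = c"
  proof (rule common_fixed_point[where H = "\<lambda>x. (norm x)\<^sup>2"])
    show "compact K" "convex K" "K \<noteq> {}" by fact+ (use \<open>z \<in> K\<close> in auto)
    show "continuous_on UNIV (\<lambda>x::'a. (norm x)\<^sup>2)" by (intro continuous_intros)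
    show "(norm ((1/2) *\<^sub>R (x + y)))\<^sup>2 = ((norm x)\<^sup>2 + (norm y)\<^sup>2) / 2 - (norm (x - y))\<^sup>2 / 4"
      for x y :: 'a
      by (simp add: power2_norm_eq_inner inner_simps inner_commute field_simps)
    fix g assume "g \<in> {g. automorphism S g}"
    then have g: "automorphism S g" by simp
    show "g x \<in> K" if "x \<in> K" for x using maps[OF g that] .
    have "C-lipschitz_on K g"
      using C g by (intro lipschitz_onI) (auto simp: dist_norm K_def)
    then show "continuous_on K g" by (rule lipschitz_on_continuous_on)
    show "g ((1/2) *\<^sub>R (x + y)) = (1/2) *\<^sub>R (g x + g y)" if "x \<in> K" "y \<in> K" for x y
      using affine_onD[OF automorphismD(1)[OF g], of x y "1/2" "1/2"] that
      by (simp add: K_def scaleR_add_right)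
    show "\<exists>k\<in>{g. automorphism S g}. \<forall>x\<in>K. k x = g (h x)" if "h \<in> {g. automorphism S g}" for h
      using automorphism_compose[OF g] that by (intro bexI[of _ "g \<circ> h"]) auto
  next
    fix x y assume xy: "x \<in> K" "y \<in> K" "x \<noteq> y"
    show "\<exists>d>0. \<forall>g\<in>{g. automorphism S g}. d \<le> (norm (g x - g y))\<^sup>2"
    proof (intro exI[of _ "(norm (x - y) / C)\<^sup>2"] conjI ballI)
      show "(norm (x - y) / C)\<^sup>2 > 0" using xy(3) C(1) by simp
      fix g assume "g \<in> {g. automorphism S g}"
      then have g: "automorphism S g" by simp
      \<comment> \<open>The Lipschitz bound for the inverse automorphism bounds
        \<open>norm (g x - g y)\<close> from below, uniformly in \<open>g\<close>.\<close>
      let ?h = "inv_into S g"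
      have "?h (g x) = x" "?h (g y) = y"
        using xy automorphismD(2)[OF g] by (auto simp: K_def bij_betw_inv_into_left)
      then have "norm (x - y) \<le> C * norm (g x - g y)"
        using C(2)[OF automorphism_inv_into[OF S(2) g], of "g x" "g y"] xy automorphismD(3)[OF g]
        by (simp add: K_def)
      then have "norm (x - y) / C \<le> norm (g x - g y)" using C(1) by (simp add: field_simps)
      then show "(norm (x - y) / C)\<^sup>2 \<le> (norm (g x - g y))\<^sup>2" using C(1) by (intro power_mono) auto
    qed
  qed
  then obtain c where c: "c \<in> K" "\<And>g. automorphism S g \<Longrightarrow> g c = c" by blast
  have "c \<in> rel_interior S"
    unfolding convex_rel_interior_iff[OF S(2,3)]
  proof
    fix x assume "x \<in> S"
    then have "(1 + t) *\<^sub>R c - t *\<^sub>R x \<in> S" using c by (simp add: K_def)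
    then show "\<exists>e>1. (1 - e) *\<^sub>R x + e *\<^sub>R c \<in> S"
      using t by (intro exI[of _ "1 + t"]) (simp add: algebra_simps)
  qed
  then show thesis using c that by blast
qed

subsection \<open>Invariant inner products\<close>

text \<open>As an element of the operator space, the adjoint can be composed with other operators,
  so that the pull-back of a form becomes a bounded linear map on that normed space.\<close>

definition blinfun_adjoint :: "('a::euclidean_space \<Rightarrow>\<^sub>L 'b::euclidean_space) \<Rightarrow> 'b \<Rightarrow>\<^sub>L 'a" where
  "blinfun_adjoint f = Blinfun (adjoint (blinfun_apply f))"

lemma linear_blinfun_apply: "linear (blinfun_apply f)"
  by (rule bounded_linear.linear[OF blinfun.bounded_linear_right])

lemma blinfun_adjoint_works: "blinfun_adjoint f x \<bullet> y = x \<bullet> f y"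
proof -
  have l: "linear (blinfun_apply f)" by (rule linear_blinfun_apply)
  then have "bounded_linear (adjoint (blinfun_apply f))"
    by (simp add: adjoint_linear linear_conv_bounded_linear[symmetric])
  then show ?thesis
    by (simp add: blinfun_adjoint_def bounded_linear_Blinfun_apply adjoint_clauses[OF l])
qed

text \<open>Cauchy-Schwarz for the square of \<open>norm (blinfun_adjoint f x)\<close>, with one
  adjoint moved across the inner product.\<close>

lemma norm_blinfun_adjoint_le: "norm (blinfun_adjoint f) \<le> norm f"
proof (rule norm_blinfun_bound)
  fix x
  let ?y = "blinfun_adjoint f x"
  have "norm ?y * norm ?y = x \<bullet> f ?y"
    by (metis blinfun_adjoint_works norm_eq_sqrt_inner real_sqrt_mult_self abs_of_nonneg inner_ge_zero)
  also have "\<dots> \<le> norm x * (norm f * norm ?y)"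
    by (meson norm_cauchy_schwarz norm_blinfun mult_left_mono norm_ge_zero order_trans)
  finally show "norm ?y \<le> norm f * norm x" by (cases "norm ?y = 0") (auto simp: mult_ac)
qed simp

text \<open>A ball of radius \<open>r\<close> inside \<open>S\<close> is sent into the ball of
  radius \<open>R\<close> that contains \<open>S\<close>, whence \<open>M = R / r\<close>.\<close>

lemma linear_symmetries_bounded:
  fixes S :: "'a::euclidean_space set"
  assumes "bounded S" "0 \<in> interior S"
  obtains M where "M > 0" "\<And>g x. \<lbrakk>linear g; g ` S \<subseteq> S\<rbrakk> \<Longrightarrow> norm (g x) \<le> M * norm x"
proof -
  obtain r where r: "r > 0" "cball 0 r \<subseteq> S" using assms(2) by (auto simp: mem_interior_cball)
  obtain R where R: "R > 0" "\<And>x. x \<in> S \<Longrightarrow> norm x \<le> R" using assms(1) by (auto simp: bounded_pos)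
  have "norm (g x) \<le> R / r * norm x" if g: "linear g" "g ` S \<subseteq> S" for g x
  proof (cases "x = 0")
    case False
    have "(r / norm x) *\<^sub>R x \<in> S" using r False by (intro subsetD[OF r(2)]) auto
    then have "norm (g ((r / norm x) *\<^sub>R x)) \<le> R" using g(2) R(2) by blast
    then show ?thesis using r(1) False by (simp add: linear_cmul[OF g(1)] field_simps)
  qed (simp add: linear_0[OF g(1)])
  moreover have "R / r > 0" using R(1) r(1) by simp
  ultimately show thesis using that by blast
qed

text \<open>The image of \<open>S\<close> contains a ball about 0, so \<open>g\<close> is
  surjective, and a surjective linear endomorphism in finite dimension is invertible.\<close>

lemma linear_symmetry_inverse:
  fixes S :: "'a::euclidean_space set"
  assumes "0 \<in> interior S" and g: "linear g" "g ` S = S"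
  obtains h where "linear h" "h ` S = S" "\<And>x. h (g x) = x" "\<And>x. g (h x) = x"
proof -
  obtain r where r: "r > 0" "cball 0 r \<subseteq> S" using assms(1) by (auto simp: mem_interior_cball)
  have "y \<in> range g" for y
  proof (cases "y = 0")
    case True
    then show ?thesis using linear_0[OF g(1)] by (metis rangeI)
  next
    case False
    have "(r / norm y) *\<^sub>R y \<in> S" using r False by (intro subsetD[OF r(2)]) auto
    then obtain x where "g x = (r / norm y) *\<^sub>R y" using g(2) by (metis imageE)
    then have "g ((norm y / r) *\<^sub>R x) = y" using r(1) False by (simp add: linear_cmul[OF g(1)])
    then show ?thesis by (metis rangeI)
  qed
  then obtain h where h: "linear h" "\<And>x. h (g x) = x" "\<And>x. g (h x) = x"
    using linear_surjective_isomorphism[OF g(1)] by auto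
  have "h ` S = h ` g ` S" using g(2) by simp
  also have "\<dots> = S" using h(2) by (simp add: image_image)
  finally show thesis using h that by blast
qed

text \<open>The fixed-point argument uses the Hilbert-Schmidt norm, which satisfies the
  parallelogram identity; this bound leads back to the operator norm.\<close>

lemma norm_blinfun_le_hilbert_schmidt:
  fixes A :: "'a::euclidean_space \<Rightarrow>\<^sub>L 'b::real_inner"
  assumes "(\<Sum>b\<in>Basis. (norm (A b))\<^sup>2) \<le> e\<^sup>2" "e \<ge> 0"
  shows "norm A \<le> real DIM('a) * e"
proof -
  have "norm (A b) \<le> e" if b: "b \<in> Basis" for b
  proof -
    have "(norm (A b))\<^sup>2 \<le> (\<Sum>b\<in>Basis. (norm (A b))\<^sup>2)"
      using b by (intro member_le_sum) auto
    then show ?thesis using assms by (meson order_trans power2_le_imp_le)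
  qed
  then have "(\<Sum>b\<in>(Basis::'a set). norm (A b)) \<le> real DIM('a) * e"
    using sum_bounded_above[of Basis "\<lambda>b. norm (A b)" e] by simp
  then show ?thesis using norm_blinfun_euclidean_le[of A] by linarith
qed

text \<open>Symmetric operators encode symmetric bilinear forms. A symmetry \<open>g\<close> pulls
  forms back by \<open>act g\<close>, and a common fixed point of these pull-backs in a compact
  convex set \<open>K\<close> of positive definite forms is an invariant inner product.\<close>

lemma invariant_inner_product:
  fixes S :: "'a::euclidean_space set"
  assumes "bounded S" and int: "0 \<in> interior S"
  obtains A :: "'a \<Rightarrow>\<^sub>L 'a" where
    "\<And>x y. A x \<bullet> y = x \<bullet> A y" "\<And>x. x \<noteq> 0 \<Longrightarrow> A x \<bullet> x > 0"
    "\<And>g x. \<lbrakk>linear g; g ` S = S\<rbrakk> \<Longrightarrow> A (g x) \<bullet> g x = A x \<bullet> x"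
proof -
  obtain M where M: "M > 0" "\<And>g x. \<lbrakk>linear g; g ` S \<subseteq> S\<rbrakk> \<Longrightarrow> norm (g x) \<le> M * norm x"
    using linear_symmetries_bounded[OF assms] by blast
  define \<G> where "\<G> = {g :: 'a \<Rightarrow>\<^sub>L 'a. g ` S = S}"
  have id: "id_blinfun \<in> \<G>" by (simp add: \<G>_def)
  have bound: "norm (g x) \<le> M * norm x" if "g \<in> \<G>" for g x
    using that M(2) by (simp add: \<G>_def linear_blinfun_apply)
  have norm_le: "norm g \<le> M" if "g \<in> \<G>" for g
    using bound[OF that] M(1) by (intro norm_blinfun_bound) auto
  have comp: "g o\<^sub>L h \<in> \<G>" if "g \<in> \<G>" "h \<in> \<G>" for g h
    using that by (auto simp: \<G>_def simp flip: image_image)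
  have inverse: "\<exists>h\<in>\<G>. (\<forall>x. h (g x) = x) \<and> (\<forall>x. g (h x) = x)" if "g \<in> \<G>" for g
  proof -
    from that have "linear (blinfun_apply g)" "g ` S = S" by (auto simp: \<G>_def linear_blinfun_apply)
    then obtain h where h: "linear h" "h ` S = S" "\<And>x. h (g x) = x" "\<And>x. g (h x) = x"
      using linear_symmetry_inverse[OF int] by metis
    then have "blinfun_apply (Blinfun h) = h"
      by (simp add: linear_conv_bounded_linear bounded_linear_Blinfun_apply)
    then show ?thesis using h by (intro bexI[of _ "Blinfun h"]) (auto simp: \<G>_def)
  qed
  have lower: "norm x / M \<le> norm (g x)" if g: "g \<in> \<G>" for g x
  proof -
    obtain h where h: "h \<in> \<G>" "h (g x) = x" using inverse[OF g] by blast
    show ?thesis using bound[OF h(1), of "g x"] h(2) M(1) by (simp add: field_simps)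
  qed
  define act where "act g A = blinfun_adjoint g o\<^sub>L A o\<^sub>L g" for g A :: "'a \<Rightarrow>\<^sub>L 'a"
  have act: "act g A x \<bullet> y = A (g x) \<bullet> g y" for g A x y
    by (simp add: act_def blinfun_adjoint_works)
  have act_eqI: "A = B" if "\<And>x y. A x \<bullet> y = B x \<bullet> y" for A B :: "'a \<Rightarrow>\<^sub>L 'a"
    using that by (intro blinfun_eqI) (metis vector_eq_rdot)
  have act_linear: "bounded_linear (act g)" for g
    unfolding act_def
    by (intro bounded_linear_compose[OF bounded_bilinear.bounded_linear_left[OF bounded_bilinear_blinfun_compose]
      bounded_bilinear.bounded_linear_right[OF bounded_bilinear_blinfun_compose]])
  \<comment> \<open>The bounds are imposed along whole orbits, which makes \<open>K\<close>
    invariant under \<open>act\<close>. The lower bound is a closed substitute for positive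
    definiteness; the upper one keeps \<open>K\<close> bounded.\<close>
  define K where "K = {A :: 'a \<Rightarrow>\<^sub>L 'a. (\<forall>x y. A x \<bullet> y = x \<bullet> A y) \<and>
    (\<forall>g\<in>\<G>. \<forall>x. (norm x / M)\<^sup>2 \<le> A (g x) \<bullet> g x \<and> A (g x) \<bullet> g x \<le> (M * norm x)\<^sup>2)}"
  have K_id: "(norm x / M)\<^sup>2 \<le> A x \<bullet> x" "A x \<bullet> x \<le> (M * norm x)\<^sup>2" if "A \<in> K" for A x
    using that id by (force simp: K_def)+
  have K_norm: "norm A \<le> M\<^sup>2" if A: "A \<in> K" for A
  proof (rule norm_blinfun_bound)
    have sym: "A x \<bullet> y = x \<bullet> A y" for x y using A by (simp add: K_def)
    have unit: "A x \<bullet> y \<le> M\<^sup>2" if "norm x \<le> 1" "norm y \<le> 1" for x y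
    proof -
      \<comment> \<open>Polarisation turns the bounds on the quadratic form into a bound on the
        bilinear form; the subtracted term is nonnegative.\<close>
      have "4 * (A x \<bullet> y) = A (x + y) \<bullet> (x + y) - A (x - y) \<bullet> (x - y)"
        using sym[of x y] by (simp add: blinfun.bilinear_simps inner_simps inner_commute)
      also have "\<dots> \<le> (M * norm (x + y))\<^sup>2"
        using K_id[OF A, of "x - y"] K_id[OF A, of "x + y"] zero_le_power2[of
          "norm (x - y) / M"] by linarith
      also have "\<dots> \<le> (M * 2)\<^sup>2"
        using M(1) that norm_triangle_ineq[of x y] by (intro power_mono mult_left_mono) auto
      finally show ?thesis by (simp add: power_mult_distrib)
    qed
    fix x
    have "norm (A x) * norm (A x) = A x \<bullet> A x" by (simp flip: power2_norm_eq_inner power2_eq_square)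
    also have "\<dots> = norm x * norm (A x) * (A (sgn x) \<bullet> sgn (A x))"
      by (cases "x = 0 \<or> A x = 0") (auto simp: sgn_div_norm blinfun.bilinear_simps field_simps)
    also have "\<dots> \<le> norm x * norm (A x) * M\<^sup>2"
      by (intro mult_left_mono unit) (auto simp: norm_sgn)
    finally show "norm (A x) \<le> M\<^sup>2 * norm x"
      by (cases "norm (A x) = 0") (auto simp: mult_ac)
  qed simp
  have "closed K"
  proof -
    have "K = (\<Inter>x. \<Inter>y. {A :: 'a \<Rightarrow>\<^sub>L 'a. A x \<bullet> y = x \<bullet> A y}) \<inter>
      (\<Inter>g\<in>\<G>. \<Inter>x. {A :: 'a \<Rightarrow>\<^sub>L 'a. (norm x / M)\<^sup>2 \<le> A (blinfun_apply g x) \<bullet> g x} \<inter>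
        {A :: 'a \<Rightarrow>\<^sub>L 'a. A (blinfun_apply g x) \<bullet> g x \<le> (M * norm x)\<^sup>2})"
      by (auto simp: K_def)
    moreover have "closed {A :: 'a \<Rightarrow>\<^sub>L 'a. A x \<bullet> y = x \<bullet> A y}" for x y
      by (intro closed_Collect_eq continuous_intros)
    moreover have "closed {A :: 'a \<Rightarrow>\<^sub>L 'a. c \<le> A x \<bullet> x}" "closed {A :: 'a \<Rightarrow>\<^sub>L 'a. A x \<bullet> x \<le> c}"
      for x c
      by (intro closed_Collect_le continuous_intros)+
    ultimately show ?thesis by (auto intro!: closed_INT closed_Int)
  qed
  moreover have "bounded K" using K_norm by (auto simp: bounded_iff)
  ultimately have "compact K" by (simp add: compact_eq_bounded_closed)
  have "convex K"
    unfolding convex_def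
  proof (intro ballI allI impI)
    fix A B and u v :: real
    assume *: "A \<in> K" "B \<in> K" "0 \<le> u" "0 \<le> v" "u + v = 1"
    have v: "v = 1 - u" using * by simp
    have "(u *\<^sub>R A + v *\<^sub>R B) x \<bullet> y = x \<bullet> (u *\<^sub>R A + v *\<^sub>R B) y" for x y
      using * by (simp add: K_def blinfun.bilinear_simps inner_simps)
    moreover have "(norm x / M)\<^sup>2 \<le> (u *\<^sub>R A + v *\<^sub>R B) (g x) \<bullet> g x \<and>
      (u *\<^sub>R A + v *\<^sub>R B) (g x) \<bullet> g x \<le> (M * norm x)\<^sup>2" if "g \<in> \<G>" for g x
    proof -
      have "A (g x) \<bullet> g x \<in> {(norm x / M)\<^sup>2 .. (M * norm x)\<^sup>2}"
        "B (g x) \<bullet> g x \<in> {(norm x / M)\<^sup>2 .. (M * norm x)\<^sup>2}"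
        using *(1,2) that unfolding K_def by auto
      from convexD[OF convex_real_interval(5) this *(3-5)]
      show ?thesis by (simp add: blinfun.bilinear_simps inner_simps)
    qed
    ultimately show "u *\<^sub>R A + v *\<^sub>R B \<in> K" by (simp add: K_def)
  qed
  \<comment> \<open>\<open>M\<close> bounds every symmetry and its inverse, so the standard inner
    product meets both bounds.\<close>
  have "id_blinfun \<in> K"
  proof -
    have "(norm x / M)\<^sup>2 \<le> (norm (g x))\<^sup>2" "(norm (g x))\<^sup>2 \<le> (M * norm x)\<^sup>2" if "g \<in> \<G>" for g x
      using bound[OF that] lower[OF that] M(1) by (auto intro!: power_mono)
    then show ?thesis by (simp add: K_def power2_norm_eq_inner)
  qed
  have "\<exists>A\<in>K. \<forall>f\<in>act ` \<G>. f A = A"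
  proof (rule common_fixed_point[where H = "\<lambda>A :: 'a \<Rightarrow>\<^sub>L 'a. \<Sum>b\<in>Basis. (norm (A b))\<^sup>2"])
    show "compact K" "convex K" "K \<noteq> {}" by fact+ (use \<open>id_blinfun \<in> K\<close> in auto)
    show "continuous_on UNIV (\<lambda>A :: 'a \<Rightarrow>\<^sub>L 'a. \<Sum>b\<in>Basis. (norm (A b))\<^sup>2)"
      by (intro continuous_intros)
    fix A B :: "'a \<Rightarrow>\<^sub>L 'a"
    have "(norm ((1/2) *\<^sub>R (x + y)))\<^sup>2 = ((norm x)\<^sup>2 + (norm y)\<^sup>2) / 2 - (norm (x - y))\<^sup>2 / 4"
      for x y :: 'a
      by (simp add: power2_norm_eq_inner inner_simps inner_commute field_simps)
    then show "(\<Sum>b\<in>Basis. (norm (((1/2) *\<^sub>R (A + B)) b))\<^sup>2) =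
        ((\<Sum>b\<in>Basis. (norm (A b))\<^sup>2) + (\<Sum>b\<in>Basis. (norm (B b))\<^sup>2)) / 2 - (\<Sum>b\<in>Basis. (norm ((A - B) b))\<^sup>2) / 4"
      by (simp only: blinfun.bilinear_simps sum.distrib sum_subtractf flip: sum_divide_distrib)
  next
    fix f assume "f \<in> act ` \<G>"
    then obtain g where g: "g \<in> \<G>" and f: "f = act g" by blast
    show "f A \<in> K" if A: "A \<in> K" for A
    proof -
      have "f A x \<bullet> y = x \<bullet> f A y" for x y
        using A by (simp add: f act inner_commute[of x "act g A y"]) (simp add: K_def inner_commute)
      moreover have "(norm x / M)\<^sup>2 \<le> f A (h x) \<bullet> h x \<and> f A (h x) \<bullet> h x \<le> (M * norm x)\<^sup>2"
        if "h \<in> \<G>" for h x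
      proof -
        have "f A (h x) \<bullet> h x = A ((g o\<^sub>L h) x) \<bullet> (g o\<^sub>L h) x" by (simp add: f act)
        then show ?thesis using A comp[OF g that] unfolding K_def by auto
      qed
      ultimately show ?thesis by (simp add: K_def)
    qed
    show "continuous_on K f" unfolding f
      by (rule linear_continuous_on[OF act_linear])
    show "f ((1/2) *\<^sub>R (A + B)) = (1/2) *\<^sub>R (f A + f B)" for A B :: "'a \<Rightarrow>\<^sub>L 'a"
      using act_linear unfolding f by (simp add: linear_add linear_cmul bounded_linear.linear)
    fix f' assume "f' \<in> act ` \<G>"
    then obtain h where h: "h \<in> \<G>" and f': "f' = act h" by blast
    \<comment> \<open>Pulling back reverses the order of composition.\<close>
    have "act (h o\<^sub>L g) A = act g (act h A)" for A by (rule act_eqI) (simp add: act)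
    then show "\<exists>k\<in>act ` \<G>. \<forall>A\<in>K. k A = f (f' A)"
      using comp[OF h g] by (auto simp: f f')
  next
    fix A B assume "A \<in> K" "B \<in> K" "A \<noteq> B"
    let ?D = "A - B"
    \<comment> \<open>Chosen so that \<open>M * (real DIM('a) * e) * M\<close> is half of
      \<open>norm ?D\<close>.\<close>
    define e where "e = norm ?D / (2 * M\<^sup>2 * real DIM('a))"
    have D: "norm ?D > 0" using \<open>A \<noteq> B\<close> by simp
    then have e: "e > 0" using M(1) by (simp add: e_def)
    have "e\<^sup>2 \<le> (\<Sum>b\<in>Basis. (norm ((act g A - act g B) b))\<^sup>2)" if g: "g \<in> \<G>" for g
    proof (rule ccontr)
      have diff: "act g A - act g B = act g ?D"
        using act_linear by (simp add: linear_diff bounded_linear.linear)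
      assume "\<not> ?thesis"
      then have *: "norm (act g ?D) \<le> real DIM('a) * e"
        using e unfolding diff by (intro norm_blinfun_le_hilbert_schmidt) auto
      obtain h where h: "h \<in> \<G>" "\<And>x. g (h x) = x" using inverse[OF g] by blast
      \<comment> \<open>Acting with the inverse recovers the difference; had \<open>act g\<close>
        shrunk it too much, its norm would be at most half of itself.\<close>
      have "?D = act h (act g ?D)" by (rule act_eqI) (simp add: act h)
      then have "norm ?D \<le> norm (blinfun_adjoint h o\<^sub>L act g ?D) * norm h"
        unfolding act_def[of h] by (metis norm_blinfun_compose)
      also have "\<dots> \<le> (norm (blinfun_adjoint h) * norm (act g ?D)) * norm h"
        by (intro mult_right_mono norm_blinfun_compose) simp
      also have "\<dots> \<le> (M * (real DIM('a) * e)) * M"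
        using norm_le[OF h(1)] norm_blinfun_adjoint_le[of h] * M(1) e
        by (intro mult_mono) auto
      also have "\<dots> = norm ?D / 2" using M(1) by (simp add: e_def power2_eq_square)
      finally show False using D by simp
    qed
    then have "\<forall>f\<in>act ` \<G>. e\<^sup>2 \<le> (\<Sum>b\<in>Basis. (norm (blinfun_apply (f A - f B) b))\<^sup>2)" by fast
    then show "\<exists>d>0. \<forall>f\<in>act ` \<G>. d \<le> (\<Sum>b\<in>Basis. (norm (blinfun_apply (f A - f B) b))\<^sup>2)"
      using zero_less_power[OF e] by fast
  qed
  then obtain A where A: "A \<in> K" "\<And>g. g \<in> \<G> \<Longrightarrow> act g A = A" by blast
  show thesis
  proof
    show "A x \<bullet> y = x \<bullet> A y" for x y using A(1) by (simp add: K_def)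
    show "A x \<bullet> x > 0" if "x \<noteq> 0" for x
    proof -
      have "(norm x / M)\<^sup>2 > 0" using that M(1) by simp
      then show ?thesis using K_id(1)[OF A(1), of x] by linarith
    qed
    fix g x assume g: "linear g" "g ` S = S"
    then have "blinfun_apply (Blinfun g) = g"
      by (simp add: linear_conv_bounded_linear bounded_linear_Blinfun_apply)
    moreover from this have "Blinfun g \<in> \<G>" using g by (simp add: \<G>_def)
    ultimately show "A (g x) \<bullet> g x = A x \<bullet> x"
      using A(2)[of "Blinfun g"] act[of "Blinfun g" A x x] by simp
  qed
qed

subsection \<open>Linear extensions and isometries\<close>

text \<open>One Gram-Schmidt step. For \<open>a = A w\<close> the hyperplane is the complement of
  \<open>w\<close> that is orthogonal for the form \<open>A\<close>.\<close>

lemma dim_conjugate_hyperplane: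
  fixes W :: "'a::euclidean_space set"
  assumes W: "subspace W" and w: "w \<in> W" "a \<bullet> w \<noteq> 0"
  shows "subspace {x \<in> W. a \<bullet> x = 0}" "dim W = Suc (dim {x \<in> W. a \<bullet> x = 0})"
proof -
  let ?H = "{x \<in> W. a \<bullet> x = 0}"
  show H: "subspace ?H"
    using W by (auto simp: subspace_def inner_simps)
  have "x \<in> span (insert w ?H)" if x: "x \<in> W" for x
  proof -
    let ?k = "a \<bullet> x / (a \<bullet> w)"
    have "x - ?k *\<^sub>R w \<in> ?H"
      using W w x by (auto simp: inner_simps intro!: subspace_diff subspace_scale)
    then show ?thesis by (auto simp: span_breakdown_eq intro: span_base)
  qed
  then have "W = span (insert w ?H)" using W w
    by (auto intro: span_minimal[THEN subsetD, rotated 2])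
  then have "dim W = dim (insert w ?H)" by (metis dim_span)
  moreover have "w \<notin> span ?H" using w H by (metis (mono_tags, lifting) mem_Collect_eq span_eq_iff)
  ultimately show "dim W = Suc (dim ?H)" by (simp add: dim_insert)
qed

text \<open>Gram-Schmidt by induction on the dimension: a vector of \<open>A\<close>-norm one goes
  to a unit vector, and the induction hypothesis treats the \<open>A\<close>-orthogonal complement
  of the first and the orthogonal complement of the second.\<close>

lemma linear_isometry_of_form_into:
  fixes A :: "'a::euclidean_space \<Rightarrow> 'a" and U :: "'b::euclidean_space set"
  assumes "linear A" and sym: "\<And>x y. A x \<bullet> y = x \<bullet> A y" and pos: "\<And>x. x \<noteq> 0 \<Longrightarrow> A x \<bullet> x > 0"
    and "subspace W" "subspace U" "dim W = dim U"
  shows "\<exists>f. linear f \<and> f ` W \<subseteq> U \<and> (\<forall>x\<in>W. (norm (f x))\<^sup>2 = A x \<bullet> x)"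
  using assms(4-6)
proof (induction "dim W" arbitrary: W U)
  case 0
  then have "W \<subseteq> {0}" by (metis dim_eq_0)
  then have "linear (\<lambda>x::'a. 0::'b) \<and> (\<lambda>x. 0) ` W \<subseteq> U \<and> (\<forall>x\<in>W. (norm (0::'b))\<^sup>2 = A x \<bullet> x)"
    using linear_0[OF assms(1)] subspace_0[OF 0(3)] by (auto simp: linear_zero)
  then show ?case by (rule exI[where x = "\<lambda>x. 0"])
next
  case (Suc k)
  have "dim W \<noteq> 0" "dim U \<noteq> 0" using Suc(2,5) by linarith+
  then have "\<not> W \<subseteq> {0}" "\<not> U \<subseteq> {0}" unfolding dim_eq_0 .
  then obtain w0 u0 where w0: "w0 \<in> W" "w0 \<noteq> 0" and u0: "u0 \<in> U" "u0 \<noteq> 0" by auto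
  define w where "w = (1 / sqrt (A w0 \<bullet> w0)) *\<^sub>R w0"
  define u where "u = sgn u0"
  have w: "w \<in> W" "A w \<bullet> w = 1"
    using w0 Suc(3) pos[OF w0(2)] by (auto simp: w_def subspace_scale linear_cmul[OF assms(1)])
  have u: "u \<in> U" "u \<bullet> u = 1"
    using u0 Suc(4) by (auto simp: u_def sgn_div_norm subspace_scale norm_sgn
      simp flip: power2_norm_eq_inner)
  let ?W = "{x \<in> W. A w \<bullet> x = 0}" and ?U = "{x \<in> U. u \<bullet> x = 0}"
  have W: "subspace ?W" "dim W = Suc (dim ?W)"
    using dim_conjugate_hyperplane[OF Suc(3) w(1), of "A w"] w(2) by auto
  have U: "subspace ?U" "dim U = Suc (dim ?U)"
    using dim_conjugate_hyperplane[OF Suc(4) u(1), of u] u(2) by auto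
  have "\<exists>f. linear f \<and> f ` ?W \<subseteq> ?U \<and> (\<forall>x\<in>?W. (norm (f x))\<^sup>2 = A x \<bullet> x)"
    using W U Suc(2,5) by (intro Suc(1)) auto
  then obtain f where f: "linear f" "\<And>x. x \<in> ?W \<Longrightarrow> f x \<in> ?U"
    "\<And>x. x \<in> ?W \<Longrightarrow> (norm (f x))\<^sup>2 = A x \<bullet> x" by blast
  \<comment> \<open>The summands are the component along \<open>w\<close>, sent along
    \<open>u\<close>, and the image of the remainder, which for \<open>x\<close> in \<open>W\<close>
    lies in \<open>?W\<close>.\<close>
  define h where "h x = (A w \<bullet> x) *\<^sub>R u + f (x - (A w \<bullet> x) *\<^sub>R w)" for x
  have "linear h"
    by (intro linearI) (auto simp: h_def inner_simps linear_add[OF f(1)] linear_diff[OF f(1)]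
        linear_cmul[OF f(1)] algebra_simps)
  moreover have "h x \<in> U \<and> (norm (h x))\<^sup>2 = A x \<bullet> x" if x: "x \<in> W" for x
  proof -
    let ?k = "A w \<bullet> x" and ?y = "x - (A w \<bullet> x) *\<^sub>R w"
    have y: "?y \<in> ?W" using x w Suc(3)
      by (auto simp: inner_simps intro!: subspace_diff subspace_scale)
    note fy = f(2)[OF y] f(3)[OF y]
    have "(norm (h x))\<^sup>2 = ?k\<^sup>2 + (norm (f ?y))\<^sup>2"
      using fy(1) u(2) unfolding h_def power2_norm_eq_inner
      by (simp add: inner_simps inner_commute power2_eq_square)
    also have "\<dots> = ?k\<^sup>2 + A ?y \<bullet> ?y" using fy(2) by simp
    also have "A ?y \<bullet> ?y = A x \<bullet> x - ?k\<^sup>2"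
      using w(2) sym[of x w]
      by (simp add: linear_diff[OF assms(1)] linear_cmul[OF assms(1)] inner_simps inner_commute power2_eq_square)
    finally have "(norm (h x))\<^sup>2 = A x \<bullet> x" by simp
    moreover have "h x \<in> U" using fy(1) u(1) Suc(4)
      by (auto simp: h_def intro!: subspace_add subspace_scale)
    ultimately show ?thesis by simp
  qed
  ultimately show ?case by blast
qed

text \<open>Positivity of the form gives injectivity, and counting dimensions then gives
  surjectivity onto \<open>V\<close>.\<close>

lemma linear_isometry_of_form:
  fixes A :: "'a::euclidean_space \<Rightarrow> 'a"
  assumes A: "linear A" "\<And>x y. A x \<bullet> y = x \<bullet> A y" "\<And>x. x \<noteq> 0 \<Longrightarrow> A x \<bullet> x > 0"
    and V: "subspace V"
  obtains f where "linear f" "bij_betw f V V" "\<And>x. x \<in> V \<Longrightarrow> (norm (f x))\<^sup>2 = A x \<bullet> x"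
proof -
  obtain f where f: "linear f" "f ` V \<subseteq> V" "\<And>x. x \<in> V \<Longrightarrow> (norm (f x))\<^sup>2 = A x \<bullet> x"
    using linear_isometry_of_form_into[OF A V V] by blast
  have "x = 0" if "x \<in> V" "f x = 0" for x
    using f(3)[OF that(1)] that(2) A(3)[of x] by force
  then have inj: "inj_on f V" using linear_injective_on_subspace_0[OF f(1) V] by blast
  then have "dim (f ` V) = dim V"
    using dim_image_eq[OF f(1), of V] V by (metis span_eq_iff)
  then have "f ` V = V" using f(2) V linear_subspace_image[OF f(1) V]
    by (intro subspace_dim_equal) auto
  then show thesis using f inj that by (auto simp: bij_betw_def)
qed

text \<open>As \<open>g 0 = 0\<close>, the quotient
  \<open>(1 / t) *\<^sub>R g (t *\<^sub>R v)\<close> is the same for all small \<open>t > 0\<close>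
  and extends \<open>g\<close> to the span; on the orthogonal complement the map is continued by the
  identity.\<close>

lemma affine_on_linear_extension:
  fixes S :: "'a::euclidean_space set" and g :: "'a \<Rightarrow> 'a"
  assumes S: "convex S" "0 \<in> rel_interior S" and g: "affine_on S g" "g 0 = 0"
  obtains L where "linear L" "\<And>x. x \<in> S \<Longrightarrow> L x = g x"
    "\<And>x. (\<And>y. y \<in> span S \<Longrightarrow> orthogonal x y) \<Longrightarrow> L x = x"
proof -
  let ?V = "span S"
  obtain r where 0: "0 \<in> S" and r: "r > 0" "cball 0 r \<inter> affine hull S \<subseteq> S"
    using S(2) by (auto simp: mem_rel_interior_cball)
  have hull: "affine hull S = ?V" using 0 by (intro affine_hull_span_0) (simp add: hull_inc)
  have small: "t *\<^sub>R v \<in> S" if "v \<in> ?V" "t \<ge> 0" "t * norm v \<le> r" for v t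
    using that r(2) span_scale[of v S t] by (auto simp: hull)
  have scale: "g (s *\<^sub>R x) = s *\<^sub>R g x" if "x \<in> S" "0 \<le> s" "s \<le> 1" for s x
    using affine_onD[OF g(1) that(1) 0, of s "1 - s"] that g(2) by simp
  have quotient: "(1 / s) *\<^sub>R g (s *\<^sub>R v) = (1 / t) *\<^sub>R g (t *\<^sub>R v)"
    if "0 < s" "s \<le> t" "t *\<^sub>R v \<in> S" for s t v
    using scale[OF that(3), of "s / t"] that by simp
  \<comment> \<open>The factor \<open>r / (1 + norm v)\<close> brings \<open>v\<close> into the ball
    of radius \<open>r\<close>, with no exception at \<open>v = 0\<close>.\<close>
  define \<phi> where "\<phi> v = (1 / (r / (1 + norm v))) *\<^sub>R g ((r / (1 + norm v)) *\<^sub>R v)" for v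
  have \<phi>: "\<phi> v = (1 / t) *\<^sub>R g (t *\<^sub>R v)" if v: "v \<in> ?V" and t: "t > 0" "t *\<^sub>R v \<in> S" for v t
  proof -
    let ?s = "r / (1 + norm v)"
    have s: "?s > 0" using r by (simp add: add_pos_nonneg)
    have "?s * norm v \<le> r"
      using r by (simp add: field_simps add_pos_nonneg)
    then have sv: "?s *\<^sub>R v \<in> S" using small[OF v] s by simp
    show ?thesis
    proof (cases "?s \<le> t")
      case True
      show ?thesis unfolding \<phi>_def by (rule quotient[OF s True t(2)])
    next
      case False
      then show ?thesis unfolding \<phi>_def by (intro quotient[OF t(1) _ sv, symmetric]) simp
    qed
  qed
  have \<phi>_add: "\<phi> (v + w) = \<phi> v + \<phi> w" if vw: "v \<in> ?V" "w \<in> ?V" for v w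
  proof -
    define t where "t = r / (2 * (1 + norm v + norm w))"
    have pos: "0 < 1 + norm v + norm w" by (simp add: add_pos_nonneg)
    then have t: "t > 0" using r by (simp add: t_def)
    have "(2 * t) * norm v \<le> r" "(2 * t) * norm w \<le> r"
      using r(1) pos by (auto simp: t_def field_simps)
    then have *: "(2 * t) *\<^sub>R v \<in> S" "(2 * t) *\<^sub>R w \<in> S" using small vw t by auto
    \<comment> \<open>The factor 2 in \<open>t\<close> leaves room to write the scaled sum as a
      midpoint of two points of \<open>S\<close>.\<close>
    have eq: "t *\<^sub>R (v + w) = (1/2) *\<^sub>R ((2 * t) *\<^sub>R v) + (1/2) *\<^sub>R ((2 * t) *\<^sub>R w)"
      by (simp add: scaleR_add_right)
    have "t *\<^sub>R (v + w) \<in> S" unfolding eq using * by (intro convexD[OF S(1)]) auto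
    then have "\<phi> (v + w) = (1 / t) *\<^sub>R g (t *\<^sub>R (v + w))" using vw t
      by (intro \<phi>) (auto intro: span_add)
    also have "\<dots> = (1 / t) *\<^sub>R ((1/2) *\<^sub>R g ((2 * t) *\<^sub>R v) + (1/2) *\<^sub>R g ((2 * t) *\<^sub>R w))"
      unfolding eq using affine_onD[OF g(1) *, of "1/2" "1/2"] by simp
    also have "\<dots> = \<phi> v + \<phi> w"
      using \<phi>[OF vw(1) _ *(1)] \<phi>[OF vw(2) _ *(2)] t by (simp add: scaleR_add_right mult.commute)
    finally show ?thesis .
  qed
  have \<phi>_0: "\<phi> 0 = 0" using g(2) by (simp add: \<phi>_def)
  have \<phi>_pos: "\<phi> (k *\<^sub>R v) = k *\<^sub>R \<phi> v" if v: "v \<in> ?V" and k: "k > 0" for k v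
  proof -
    define t where "t = r / (1 + norm (k *\<^sub>R v))"
    have t: "t > 0" using r by (simp add: t_def add_pos_nonneg)
    have "t * norm (k *\<^sub>R v) \<le> r" unfolding t_def using r(1)
      by (simp add: field_simps add_pos_nonneg)
    then have *: "t *\<^sub>R (k *\<^sub>R v) \<in> S" using small[of "k *\<^sub>R v" t] v t by (auto intro: span_scale)
    then have "\<phi> (k *\<^sub>R v) = (1 / t) *\<^sub>R g (t *\<^sub>R (k *\<^sub>R v))" using v t
      by (intro \<phi>) (auto intro: span_scale)
    moreover have "\<phi> v = (1 / (t * k)) *\<^sub>R g ((t * k) *\<^sub>R v)" using * t k by (intro \<phi>[OF v]) auto
    ultimately show ?thesis using k by simp
  qed
  have \<phi>_neg: "\<phi> (- v) = - \<phi> v" if v: "v \<in> ?V" for v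
    using \<phi>_add[OF v span_neg[OF v]] \<phi>_0 by (simp add: eq_neg_iff_add_eq_0 add.commute)
  have \<phi>_scale: "\<phi> (k *\<^sub>R v) = k *\<^sub>R \<phi> v" if v: "v \<in> ?V" for k v
  proof (cases k "0::real" rule: linorder_cases)
    case less
    then show ?thesis using \<phi>_pos[OF v, of "- k"] \<phi>_neg[OF span_scale[OF v, of k]] by simp
  qed (use \<phi>_0 \<phi>_pos[OF v] in auto)
  obtain B where B: "B \<subseteq> ?V" "pairwise orthogonal B" "\<And>x. x \<in> B \<Longrightarrow> norm x = 1" "independent B"
    "span B = ?V"
    using orthonormal_basis_subspace[OF subspace_span[of S]] by metis
  define P where "P x = (\<Sum>b\<in>B. (x \<bullet> b) *\<^sub>R b)" for x
  have fin: "finite B" using B(4) by (rule independent_imp_finite)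
  have P: "linear P" unfolding P_def
    by (intro linearI) (auto simp: inner_simps sum.distrib scaleR_add_left scaleR_sum_right)
  have P_V: "P x \<in> ?V" for x unfolding P_def using B(1) by (auto intro!: span_sum span_scale)
  have "P b = b" if b: "b \<in> B" for b
  proof -
    have "(b \<bullet> b') *\<^sub>R b' = (if b' = b then b else 0)" if "b' \<in> B" for b'
      using B(2) B(3)[OF b] b that by (auto simp: pairwise_def orthogonal_def norm_eq_1)
    then show ?thesis unfolding P_def using fin b by (simp cong: sum.cong)
  qed
  then have P_id: "P x = x" if "x \<in> ?V" for x
    using linear_eq_on_span[OF P linear_ident, of B] that B(5) by auto
  have P_orth: "P x = 0" if "\<And>y. y \<in> ?V \<Longrightarrow> orthogonal x y" for x
    unfolding P_def using that B(1) by (intro sum.neutral) (auto simp: orthogonal_def)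
  \<comment> \<open>\<open>P\<close> is the orthogonal projection onto the span, so \<open>L\<close>
    is \<open>\<phi>\<close> there and the identity on the complement.\<close>
  define L where "L x = \<phi> (P x) + (x - P x)" for x
  show thesis
  proof
    show "linear L"
      by (intro linearI) (auto simp: L_def linear_add[OF P] linear_cmul[OF P] \<phi>_add P_V \<phi>_scale algebra_simps)
    show "L x = g x" if "x \<in> S" for x
      using \<phi>[of x 1] P_id[of x] that by (simp add: L_def span_base)
    show "L x = x" if "\<And>y. y \<in> ?V \<Longrightarrow> orthogonal x y" for x
      using P_orth[of x] that by (simp add: L_def \<phi>_0)
  qed
qed

subsection \<open>The ellipsoid\<close>

text \<open>In coordinates centred at \<open>c\<close>, automorphisms extend to linear maps, and a
  body with 0 in its interior has an inner product invariant under its linear symmetries.\<close>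

lemma automorphism_invariant_form:
  fixes S :: "'a::euclidean_space set"
  assumes S: "compact S" "convex S" and c: "c \<in> rel_interior S"
    and fixed: "\<And>g. automorphism S g \<Longrightarrow> g c = c"
  obtains A :: "'a \<Rightarrow> 'a" where "linear A" "\<And>x y. A x \<bullet> y = x \<bullet> A y"
    "\<And>x. x \<noteq> 0 \<Longrightarrow> A x \<bullet> x > 0"
    "\<And>g x. \<lbrakk>automorphism S g; x \<in> S\<rbrakk> \<Longrightarrow> A (g x - c) \<bullet> (g x - c) = A (x - c) \<bullet> (x - c)"
proof -
  define S0 where "S0 = (\<lambda>x. x - c) ` S"
  let ?V = "span S0"
  define D where "D = {z. norm z \<le> 1 \<and> (\<forall>y\<in>?V. orthogonal z y)}"
  \<comment> \<open>Thickening \<open>S0\<close> orthogonally gives a full-dimensional body, of which every automorphism of \<open>S\<close>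
    fixing \<open>c\<close> induces a linear symmetry.\<close>
  define T where "T = {a + b |a b. a \<in> S0 \<and> b \<in> D}"
  have cS: "c \<in> S" using c rel_interior_subset by blast
  have S0: "convex S0" "compact S0"
    using S by (auto simp: S0_def convex_translation_subtract_eq compact_translation_subtract)
  have zero: "0 \<in> rel_interior S0"
    using c rel_interior_translation[of "- c" S] by (force simp: S0_def)
  have mem: "x \<in> S0 \<longleftrightarrow> x + c \<in> S" for x
    by (auto simp: S0_def image_iff intro: bexI[of _ "x + c"])
  have "0 \<in> S0" using cS by (simp add: mem)
  have "bounded D" by (auto simp: D_def bounded_iff)
  moreover have "T = (\<lambda>(x, y). x + y) ` (S0 \<times> D)" by (auto simp: T_def)
  ultimately have "bounded T" using bounded_plus[OF compact_imp_bounded[OF S0(2)]] by simp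
  moreover have "0 \<in> interior T"
  proof -
    obtain r where r: "r > 0" "cball 0 r \<inter> affine hull S0 \<subseteq> S0"
      using zero by (auto simp: mem_rel_interior_cball)
    have hull: "affine hull S0 = ?V" using \<open>0 \<in> S0\<close>
      by (intro affine_hull_span_0) (simp add: hull_inc)
    have "x \<in> T" if x: "norm x \<le> min r 1" for x
    proof -
      obtain y z where yz: "y \<in> ?V" "\<And>w. w \<in> ?V \<Longrightarrow> orthogonal z w" "x = y + z"
        using orthogonal_subspace_decomp_exists[of S0 x] by metis
      \<comment> \<open>By Pythagoras both components are no longer than \<open>x\<close>, so a ball
        of radius \<open>min r 1\<close> fits into \<open>T\<close>.\<close>
      then have "(norm x)\<^sup>2 = (norm y)\<^sup>2 + (norm z)\<^sup>2"
        by (simp add: norm_add_Pythagorean orthogonal_commute)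
      then have "(norm y)\<^sup>2 \<le> (norm x)\<^sup>2" "(norm z)\<^sup>2 \<le> (norm x)\<^sup>2" by auto
      then have "norm y \<le> norm x" "norm z \<le> norm x" by (meson norm_ge_zero power2_le_imp_le)+
      then have "y \<in> S0" "z \<in> D" using x yz r(2) by (auto simp: D_def hull)
      then show ?thesis using yz(3) by (auto simp: T_def)
    qed
    then have "cball 0 (min r 1) \<subseteq> T" by auto
    then show ?thesis using r(1) by (auto simp: mem_interior_cball intro!: exI[of _ "min r 1"])
  qed
  ultimately obtain A :: "'a \<Rightarrow>\<^sub>L 'a" where A: "\<And>x y. A x \<bullet> y = x \<bullet> A y" "\<And>x. x \<noteq> 0 \<Longrightarrow> A x \<bullet> x > 0"
    "\<And>g x. \<lbrakk>linear g; g ` T = T\<rbrakk> \<Longrightarrow> A (g x) \<bullet> g x = A x \<bullet> x"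
    using invariant_inner_product by blast
  have "A (g x - c) \<bullet> (g x - c) = A (x - c) \<bullet> (x - c)"
    if g: "automorphism S g" and x: "x \<in> S" for g x
  proof -
    define g0 where "g0 y = g (y + c) - c" for y
    have "affine_on S0 g0"
      unfolding affine_on_def
    proof (intro ballI allI impI)
      fix y z and u v :: real
      assume *: "y \<in> S0" "z \<in> S0" "0 \<le> u" "0 \<le> v" "u + v = 1"
      have "u *\<^sub>R y + v *\<^sub>R z + c = u *\<^sub>R (y + c) + v *\<^sub>R (z + c)"
        using *(5) by (simp add: algebra_simps flip: scaleR_left_distrib)
      moreover have "u *\<^sub>R c + v *\<^sub>R c = c" using *(5) by (simp flip: scaleR_left_distrib)
      ultimately have "g0 (u *\<^sub>R y + v *\<^sub>R z) = g (u *\<^sub>R (y + c) + v *\<^sub>R (z + c)) - (u *\<^sub>R c + v *\<^sub>R c)"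
        by (simp add: g0_def)
      then show "g0 (u *\<^sub>R y + v *\<^sub>R z) = u *\<^sub>R g0 y + v *\<^sub>R g0 z"
        using affine_onD[OF automorphismD(1)[OF g], of "y + c" "z + c" u v] *
        by (simp add: g0_def mem scaleR_diff_right)
    qed
    moreover have "g0 0 = 0" using fixed[OF g] by (simp add: g0_def)
    ultimately obtain L where L: "linear L" "\<And>x. x \<in> S0 \<Longrightarrow> L x = g0 x"
      "\<And>x. (\<And>y. y \<in> ?V \<Longrightarrow> orthogonal x y) \<Longrightarrow> L x = x"
      using affine_on_linear_extension[OF S0(1) zero] by blast
    have "L ` S0 = g0 ` S0" using L(2) by (intro image_cong) auto
    also have "\<dots> = (\<lambda>x. x - c) ` g ` S" by (auto simp: S0_def g0_def image_image)
    also have "\<dots> = S0" using automorphismD(2)[OF g] by (simp add: S0_def bij_betw_def)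
    finally have LS: "L ` S0 = S0" .
    have LD: "L b = b" if "b \<in> D" for b using that L(3) by (auto simp: D_def)
    \<comment> \<open>\<open>L\<close> permutes \<open>S0\<close> and fixes \<open>D\<close>
      pointwise, hence preserves their sum.\<close>
    have "L ` T = T"
    proof
      show "L ` T \<subseteq> T" using LS LD by (force simp: T_def linear_add[OF L(1)])
      show "T \<subseteq> L ` T"
      proof
        fix y assume "y \<in> T"
        then obtain a b where ab: "a \<in> S0" "b \<in> D" "y = a + b" by (auto simp: T_def)
        then obtain a' where "a' \<in> S0" "a = L a'" using LS by blast
        then have "y = L (a' + b)" "a' + b \<in> T" using ab LD
          by (auto simp: T_def linear_add[OF L(1)])
        then show "y \<in> L ` T" by blast
      qed
    qed
    from A(3)[OF L(1) this, of "x - c"] show ?thesis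
      using L(2)[of "x - c"] x by (simp add: mem g0_def)
  qed
  then show thesis using A(1,2) that[of "blinfun_apply A"] linear_blinfun_apply by blast
qed

section \<open>Distinguishable pairs and 2-spectrality\<close>

text \<open>A list of length one would make \<open>x\<close> itself extreme, so only a pair
  remains.\<close>

lemma spectrality_2_cases:
  assumes "spectrality 2 S" "x \<in> S" "\<not> x extreme_point_of S"
  obtains s t u where "(s, t) \<in> distinguishable_pairs S" "0 \<le> u" "u \<le> 1"
    "x = (1 - u) *\<^sub>R s + u *\<^sub>R t"
proof -
  obtain xs and c :: "nat \<Rightarrow> real" where xs: "1 \<le> length xs" "length xs \<le> 2"
    "set xs \<subseteq> extreme_points S" "distinguishable S xs" "\<forall>j<length xs. c j \<ge> 0"
    "(\<Sum>j<length xs. c j) = 1" "x = (\<Sum>j<length xs. c j *\<^sub>R (xs ! j))"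
    using assms(1,2) unfolding spectrality_def by meson
  have "length xs \<noteq> 1"
  proof
    assume "length xs = 1"
    then obtain s where "xs = [s]" by (auto simp: length_Suc_conv)
    then show False using xs assms(3) by (simp add: extreme_points_def)
  qed
  then have "length xs = 2" using xs by linarith
  then obtain s t where st: "xs = [s, t]" by (auto simp: length_Suc_conv numeral_2_eq_2)
  then have "c 0 = 1 - c 1" using xs(6) by (simp add: lessThan_Suc)
  moreover have "c 0 \<ge> 0" "c 1 \<ge> 0" using xs(5) st by auto
  moreover have "x = c 0 *\<^sub>R s + c 1 *\<^sub>R t" using xs(7) st by (simp add: lessThan_Suc add.commute)
  moreover have "(s, t) \<in> distinguishable_pairs S" using xs(3,4) st
    by (simp add: distinguishable_pairs_def)
  ultimately show thesis using that[of s t "c 1"] by simp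
qed

lemma affine_on_one_minus:
  fixes e :: "'a::real_vector \<Rightarrow> real"
  assumes "affine_on S e"
  shows "affine_on S (\<lambda>x. 1 - e x)"
  unfolding affine_on_def
proof (intro ballI allI impI)
  fix x y and u v :: real
  assume *: "x \<in> S" "y \<in> S" "0 \<le> u" "0 \<le> v" "u + v = 1"
  have "u *\<^sub>R (1 - e x) + v *\<^sub>R (1 - e y) = (u + v) - (u * e x + v * e y)"
    by (simp add: algebra_simps)
  then show "1 - e (u *\<^sub>R x + v *\<^sub>R y) = u *\<^sub>R (1 - e x) + v *\<^sub>R (1 - e y)"
    using affine_onD[OF assms *] *(5) by simp
qed

text \<open>The two functionals sum to one, so the second is \<open>1 - e\<close> and a single
  functional with values in the unit interval carries all the data.\<close>

lemma distinguishable_pair_iff: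
  "distinguishable S [s, t] \<longleftrightarrow> s \<in> S \<and> t \<in> S \<and>
    (\<exists>e::'a::real_vector \<Rightarrow> real. affine_on S e \<and> (\<forall>x\<in>S. 0 \<le> e x \<and> e x \<le> 1) \<and> e s = 1 \<and> e t = 0)"
  (is "?L \<longleftrightarrow> ?R")
proof
  assume ?L
  then obtain e :: "nat \<Rightarrow> 'a \<Rightarrow> real" where st: "s \<in> S" "t \<in> S"
    and e': "\<forall>i<2. affine_on S (e i) \<and> (\<forall>x\<in>S. e i x \<ge> 0)" "\<forall>x\<in>S. e 0 x + e 1 x = 1"
      "\<forall>i<2. e i ([s, t] ! i) = 1"
    unfolding distinguishable_def by (auto simp: lessThan_Suc numeral_2_eq_2 add.commute)
  have e: "affine_on S (e 0)" "\<And>x. x \<in> S \<Longrightarrow> e 0 x \<ge> 0" "\<And>x. x \<in> S \<Longrightarrow> e 1 x \<ge> 0"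
    "\<And>x. x \<in> S \<Longrightarrow> e 0 x + e 1 x = 1" "e 0 s = 1" "e 1 t = 1"
    using e'(1) e'(2) e'(3)[rule_format, of 0] e'(3)[rule_format, of 1] by auto
  have "e 0 x \<le> 1" if "x \<in> S" for x using e(3,4)[OF that] by linarith
  moreover have "e 0 t = 0" using e(4)[OF st(2)] e(6) by linarith
  ultimately show ?R using st e by blast
next
  assume ?R
  then obtain e :: "'a \<Rightarrow> real" where st: "s \<in> S" "t \<in> S"
    and e: "affine_on S e" "\<And>x. x \<in> S \<Longrightarrow> 0 \<le> e x" "\<And>x. x \<in> S \<Longrightarrow> e x \<le> 1" "e s = 1" "e t = 0" by blast
  have "affine_on S (\<lambda>x. 1 - e x)"
    using e(1) by (rule affine_on_one_minus)
  then show ?L using st e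
    by (auto simp: distinguishable_def lessThan_Suc less_Suc_eq
        intro!: exI[of _ "\<lambda>i::nat. if i = 0 then e else (\<lambda>x. 1 - e x)"])
qed

text \<open>Replace \<open>e\<close> by \<open>1 - e\<close>. Transitivity, applied to a pair and
  its swap, then yields an automorphism exchanging the two points.\<close>

lemma distinguishable_pairs_swap:
  assumes "(s, t) \<in> distinguishable_pairs S"
  shows "(t, s) \<in> distinguishable_pairs S"
proof -
  obtain e :: "'a \<Rightarrow> real" where st: "s \<in> extreme_points S" "t \<in> extreme_points S" "s \<in> S" "t \<in> S"
    and e: "affine_on S e" "\<And>x. x \<in> S \<Longrightarrow> 0 \<le> e x \<and> e x \<le> 1" "e s = 1" "e t = 0"
    using assms by (auto simp: distinguishable_pairs_def distinguishable_pair_iff)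
  have "affine_on S (\<lambda>x. 1 - e x)"
    using e(1) by (rule affine_on_one_minus)
  then show ?thesis using st e
    by (auto simp: distinguishable_pairs_def distinguishable_pair_iff
      intro!: exI[of _ "\<lambda>x. 1 - e x"])
qed

lemma distinguishable_pairs_neq:
  assumes "(s, t) \<in> distinguishable_pairs S"
  shows "s \<noteq> t"
  using assms by (auto simp: distinguishable_pairs_def distinguishable_pair_iff)

lemma distinguishable_pairs_antipodal:
  assumes S: "convex S" and c: "c \<in> S" "\<not> c extreme_point_of S"
    and fixed: "\<And>g. automorphism S g \<Longrightarrow> g c = c"
    and transitive: "\<And>s1 s2 t1 t2. \<lbrakk>(s1, s2) \<in> distinguishable_pairs S; (t1, t2) \<in> distinguishable_pairs S\<rbrakk>
      \<Longrightarrow> \<exists>g. automorphism S g \<and> g s1 = t1 \<and> g s2 = t2"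
    and spec: "spectrality 2 S"
    and t: "(t1, t2) \<in> distinguishable_pairs S"
  shows "t1 + t2 = 2 *\<^sub>R c"
proof -
  obtain s1 s2 u where s: "(s1, s2) \<in> distinguishable_pairs S" and u: "0 \<le> u" "u \<le> 1"
    "c = (1 - u) *\<^sub>R s1 + u *\<^sub>R s2"
    using spectrality_2_cases[OF spec c] by metis
  have S12: "s1 \<in> S" "s2 \<in> S" using s distinguishable_pairs_subset by blast+
  have conv: "c = (1 - u) *\<^sub>R g s1 + u *\<^sub>R g s2" if g: "automorphism S g" for g
    using affine_onD[OF automorphismD(1)[OF g] S12, of "1 - u" u] u fixed[OF g] by simp
  have half: "g ((1/2) *\<^sub>R s1 + (1/2) *\<^sub>R s2) = (1/2) *\<^sub>R g s1 + (1/2) *\<^sub>R g s2"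
    if "automorphism S g" for g
    using affine_onD[OF automorphismD(1)[OF that] S12, of "1/2" "1/2"] by simp
  obtain g where "automorphism S g" "g s1 = s2" "g s2 = s1"
    using transitive[OF s distinguishable_pairs_swap[OF s]] by blast
  \<comment> \<open>Adding the decomposition of \<open>c\<close> to its image under the swap cancels
    the unknown weight \<open>u\<close>.\<close>
  from conv[OF this(1)] this(2,3) have
    "c + c = ((1 - u) *\<^sub>R s1 + u *\<^sub>R s2) + ((1 - u) *\<^sub>R s2 + u *\<^sub>R s1)"
    using u(3) by simp
  then have "c + c = s1 + s2" by (simp add: algebra_simps)
  then have mid: "c = (1/2) *\<^sub>R s1 + (1/2) *\<^sub>R s2" by (metis scaleR_half_double scaleR_add_right)
  obtain h where h: "automorphism S h" "h s1 = t1" "h s2 = t2" using transitive[OF s t] by blast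
  then have "c = (1/2) *\<^sub>R t1 + (1/2) *\<^sub>R t2" using half[OF h(1)] fixed[OF h(1)] mid by metis
  then show ?thesis by (simp add: scaleR_add_right)
qed

text \<open>A non-extreme point lies between \<open>c\<close> and a point \<open>t\<close> of
  \<open>S\<close> with \<open>q (t - c) = \<rho>\<close>, which bounds \<open>q\<close> on
  \<open>S\<close>. Conversely every ray from \<open>c\<close> in the affine hull meets such a
  \<open>t\<close>, so \<open>S\<close> fills the ellipsoid.\<close>

lemma spectral_transitive_imp_ellipsoid:
  fixes S :: "'a::euclidean_space set"
  assumes S: "compact S" "convex S" and ne: "\<not> S \<subseteq> {c}" and c: "c \<in> rel_interior S"
    and fixed: "\<And>g. automorphism S g \<Longrightarrow> g c = c"
    and transitive: "\<And>s1 s2 t1 t2. \<lbrakk>(s1, s2) \<in> distinguishable_pairs S; (t1, t2) \<in> distinguishable_pairs S\<rbrakk>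
      \<Longrightarrow> \<exists>g. automorphism S g \<and> g s1 = t1 \<and> g s2 = t2"
    and spec: "spectrality 2 S"
  obtains A :: "'a \<Rightarrow> 'a" and \<rho> :: real where "linear A" "\<And>x y. A x \<bullet> y = x \<bullet> A y"
    "\<And>x. x \<noteq> 0 \<Longrightarrow> A x \<bullet> x > 0" "\<rho> > 0"
    "S = {x \<in> affine hull S. A (x - c) \<bullet> (x - c) \<le> \<rho>}"
proof -
  have cS: "c \<in> S" using c rel_interior_subset by blast
  obtain A :: "'a \<Rightarrow> 'a" where A: "linear A" "\<And>x y. A x \<bullet> y = x \<bullet> A y" "\<And>x. x \<noteq> 0 \<Longrightarrow> A x \<bullet> x > 0"
    "\<And>g x. \<lbrakk>automorphism S g; x \<in> S\<rbrakk> \<Longrightarrow> A (g x - c) \<bullet> (g x - c) = A (x - c) \<bullet> (x - c)"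
    using automorphism_invariant_form[OF S c] fixed by blast
  define q where "q x = A x \<bullet> x" for x
  have q_scale: "q (k *\<^sub>R x) = k\<^sup>2 * q x" for k x
    by (simp add: q_def linear_cmul[OF A(1)] power2_eq_square)
  have not_extreme: "\<not> c + k *\<^sub>R (x - c) extreme_point_of S"
    if "x \<in> S" "x \<noteq> c" "0 < k" "k < 1" for x k
  proof -
    have "c + k *\<^sub>R (x - c) \<in> open_segment c x"
      using that by (auto simp: in_segment algebra_simps intro!: exI[of _ k])
    then show ?thesis using that cS by (auto simp: extreme_point_of_def)
  qed
  have c_ext: "\<not> c extreme_point_of S"
  proof
    assume ext: "c extreme_point_of S"
    obtain x where x: "x \<in> S" "x \<noteq> c" using ne by blast
    then obtain e where e: "e > 1" "(1 - e) *\<^sub>R x + e *\<^sub>R c \<in> S"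
      using c convex_rel_interior_iff[OF S(2)] cS by blast
    \<comment> \<open>\<open>?y\<close> lies beyond \<open>c\<close> on the line from
      \<open>x\<close>, so \<open>c\<close> is strictly between \<open>x\<close> and
      \<open>?y\<close>.\<close>
    let ?y = "(1 - e) *\<^sub>R x + e *\<^sub>R c"
    have "?y - c = (1 - e) *\<^sub>R (x - c)" by (simp add: algebra_simps)
    then have "?y \<noteq> c" using e x by auto
    have "c = ?y + ((e - 1) / e) *\<^sub>R (x - ?y)"
    proof -
      have "x - ?y = e *\<^sub>R (x - c)" by (simp add: algebra_simps)
      then have "((e - 1) / e) *\<^sub>R (x - ?y) = (e - 1) *\<^sub>R (x - c)" using e by simp
      then show ?thesis by (simp add: algebra_simps)
    qed
    then have "c = (1 - (e - 1) / e) *\<^sub>R ?y + ((e - 1) / e) *\<^sub>R x" by (simp add: algebra_simps)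
    moreover have "?y \<noteq> x"
    proof
      assume "?y = x"
      then have "e *\<^sub>R (x - c) = 0" by (auto simp: algebra_simps)
      then show False using e x by simp
    qed
    ultimately have "c \<in> open_segment ?y x" unfolding in_segment
      using e(1) by (intro conjI exI[of _ "(e - 1) / e"]) auto
    then show False using ext e(2) x(1) by (auto simp: extreme_point_of_def)
  qed
  obtain s1 s2 where s: "(s1, s2) \<in> distinguishable_pairs S"
    using spectrality_2_cases[OF spec cS c_ext] by metis
  have antipodal: "t1 + t2 = 2 *\<^sub>R c" if "(t1, t2) \<in> distinguishable_pairs S" for t1 t2
    by (rule distinguishable_pairs_antipodal[OF S(2) cS c_ext _ _ spec that])
      (use fixed transitive in blast)+
  \<comment> \<open>Transitivity and the invariance of \<open>q\<close> make this value the same for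
    all distinguishable pairs.\<close>
  define \<rho> where "\<rho> = q (s1 - c)"
  have "s1 \<noteq> c"
    using antipodal[OF s] distinguishable_pairs_neq[OF s] by (auto simp: scaleR_2)
  then have \<rho>: "\<rho> > 0" using A(3) by (simp add: \<rho>_def q_def)
  have radius: "q (t1 - c) = \<rho>" if t: "(t1, t2) \<in> distinguishable_pairs S" for t1 t2
  proof -
    obtain g where g: "automorphism S g" "g s1 = t1" using transitive[OF s t] by blast
    moreover have "s1 \<in> S" using s distinguishable_pairs_subset by blast
    ultimately show ?thesis using A(4)[of g s1] by (simp add: q_def \<rho>_def)
  qed
  have diameter: "\<exists>t \<mu>. t \<in> S \<and> 0 \<le> \<mu> \<and> \<mu> \<le> 1 \<and> q (t - c) = \<rho> \<and> x - c = \<mu> *\<^sub>R (t - c)"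
    if x: "x \<in> S" "\<not> x extreme_point_of S" for x
  proof -
    obtain t1 t2 u where t: "(t1, t2) \<in> distinguishable_pairs S" and u: "0 \<le> u" "u \<le> 1"
      "x = (1 - u) *\<^sub>R t1 + u *\<^sub>R t2"
      using spectrality_2_cases[OF spec x] by metis
    have tS: "t1 \<in> S" "t2 \<in> S" using t distinguishable_pairs_subset by blast+
    have t2: "t2 = 2 *\<^sub>R c - t1" using antipodal[OF t] by (simp add: algebra_simps)
    have neg: "t1 - c = - (t2 - c)" "t2 - c = - (t1 - c)" unfolding t2 by (simp_all add: scaleR_2)
    have combination: "x - c = (1 - u) *\<^sub>R (t1 - c) + u *\<^sub>R (t2 - c)"
      unfolding u(3) by (simp add: algebra_simps)
    have sum: "(1 - u) *\<^sub>R d + u *\<^sub>R (- d) = (1 - u - u) *\<^sub>R d"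
      "(1 - u) *\<^sub>R (- d) + u *\<^sub>R d = (u + u - 1) *\<^sub>R d" for d :: 'a
      by (simp_all only: diff_conv_add_uminus scaleR_left_distrib scaleR_minus_left scaleR_minus_right
          scaleR_one minus_minus minus_add_distrib add_ac)
    have x1: "x - c = (1 - u - u) *\<^sub>R (t1 - c)"
      by (rule trans[OF combination sum(1)[of "t1 - c", folded neg(2)]])
    have x2: "x - c = (u + u - 1) *\<^sub>R (t2 - c)"
      by (rule trans[OF combination sum(2)[of "t2 - c", folded neg(1)]])
    \<comment> \<open>The endpoint carrying at least half of the weight is taken, which keeps the
      coefficient \<open>\<mu>\<close> nonnegative.\<close>
    show ?thesis
    proof (cases "u \<le> 1/2")
      case True
      then show ?thesis using tS u radius[OF t] x1
        by (intro exI[of _ t1] exI[of _ "1 - u - u"]) simp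
    next
      case False
      then show ?thesis
        using tS u radius[OF distinguishable_pairs_swap[OF t]] x2
        by (intro exI[of _ t2] exI[of _ "u + u - 1"]) simp
    qed
  qed
  have "q (x - c) \<le> \<rho>" if x: "x \<in> S" for x
  proof (cases "x = c")
    case True
    then show ?thesis using \<rho> by (simp add: q_def)
  next
    case False
    \<comment> \<open>\<open>x\<close> may be extreme, where \<open>diameter\<close> says nothing;
      it is first shrunk towards \<open>c\<close>, and then \<open>k\<close> tends to 1 from
      below.\<close>
    have bound: "k\<^sup>2 * q (x - c) \<le> \<rho>" if k: "0 < k" "k < 1" for k
    proof -
      have "c + k *\<^sub>R (x - c) = (1 - k) *\<^sub>R c + k *\<^sub>R x" by (simp add: algebra_simps)
      then have "c + k *\<^sub>R (x - c) \<in> S" using convexD[OF S(2) cS x, of "1 - k" k] k by simp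
      then obtain t \<mu> where t: "0 \<le> \<mu>" "\<mu> \<le> 1" "q (t - c) = \<rho>" "k *\<^sub>R (x - c) = \<mu> *\<^sub>R (t - c)"
        using diameter[OF _ not_extreme[OF x False k]] by auto
      then have "k\<^sup>2 * q (x - c) = \<mu>\<^sup>2 * \<rho>" using q_scale by metis
      also have "\<dots> \<le> 1 * \<rho>" using t \<rho> by (intro mult_right_mono) (auto intro: power_le_one)
      finally show ?thesis by simp
    qed
    have "((\<lambda>k. k\<^sup>2 * q (x - c)) \<longlongrightarrow> 1\<^sup>2 * q (x - c)) (at_left 1)"
      by (intro tendsto_intros)
    moreover have "eventually (\<lambda>k::real. k\<^sup>2 * q (x - c) \<le> \<rho>) (at_left 1)"
      using bound by (auto simp: eventually_at_left[of 0] intro!: exI[of _ 0])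
    ultimately show ?thesis
      using tendsto_upperbound[of "\<lambda>k. k\<^sup>2 * q (x - c)" "1\<^sup>2 * q (x - c)" "at_left 1" \<rho>]
      by (simp add: trivial_limit_at_left_real)
  qed
  moreover have "x \<in> S" if x: "x \<in> affine hull S" "q (x - c) \<le> \<rho>" for x
  proof (cases "x = c")
    case False
    obtain r where r: "r > 0" "cball c r \<inter> affine hull S \<subseteq> S"
      using c by (auto simp: mem_rel_interior_cball)
    define k where "k = r / norm (x - c)"
    have k: "k > 0" using r(1) False by (simp add: k_def)
    have y: "c + k *\<^sub>R (x - c) \<in> S"
    proof -
      have "c + k *\<^sub>R (x - c) \<in> affine hull S"
        using mem_affine_3_minus[OF affine_affine_hull, of c S x c k] x cS by (simp add: hull_inc)
      moreover have "c + k *\<^sub>R (x - c) \<in> cball c r" using r(1) False by (simp add: dist_norm k_def)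
      ultimately show ?thesis using r(2) by blast
    qed
    \<comment> \<open>The point found in \<open>S\<close> may be extreme; halving its distance from
      \<open>c\<close> rules this out.\<close>
    let ?z = "c + (1/2) *\<^sub>R ((c + k *\<^sub>R (x - c)) - c)"
    have "?z = (1/2) *\<^sub>R c + (1/2) *\<^sub>R (c + k *\<^sub>R (x - c))"
      by (simp add: scaleR_add_right flip: scaleR_left_distrib add.assoc)
    then have "?z \<in> S" using convexD[OF S(2) cS y, of "1/2" "1/2"] by simp
    moreover have "\<not> ?z extreme_point_of S" using k False by (intro not_extreme[OF y]) auto
    ultimately obtain t \<mu> where t: "t \<in> S" "0 \<le> \<mu>" "\<mu> \<le> 1" "q (t - c) = \<rho>" "?z - c = \<mu> *\<^sub>R (t - c)"
      using diameter by blast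
    \<comment> \<open>\<open>x\<close> and \<open>?z\<close> lie on one ray, so \<open>x\<close> is
      \<open>m\<close> times as far from \<open>c\<close> as \<open>t\<close>, and
      \<open>q (x - c) \<le> \<rho>\<close> forces \<open>m \<le> 1\<close>.\<close>
    define m where "m = 2 * \<mu> / k"
    have "x - c = (2 / k) *\<^sub>R (?z - c)" using k by simp
    also have "\<dots> = m *\<^sub>R (t - c)" unfolding t(5) by (simp add: m_def)
    finally have xm: "x - c = m *\<^sub>R (t - c)" .
    have m: "m \<ge> 0" using t k by (simp add: m_def)
    have "m\<^sup>2 * \<rho> \<le> \<rho>" using x(2) xm q_scale t(4) by metis
    then have "m\<^sup>2 \<le> 1\<^sup>2" using \<rho> by simp
    then have "m \<le> 1" by (rule power2_le_imp_le) simp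
    moreover have "x = (1 - m) *\<^sub>R c + m *\<^sub>R t" using xm by (simp add: algebra_simps)
    ultimately show ?thesis using convexD[OF S(2) cS t(1), of "1 - m" m] m by simp
  qed (use cS in simp)
  ultimately have "S = {x \<in> affine hull S. A (x - c) \<bullet> (x - c) \<le> \<rho>}"
    by (auto simp: q_def hull_inc)
  then show thesis using that A(1-3) \<rho> by blast
qed

text \<open>The bijection is the linear map that turns the form into the squared norm, recentred at
  \<open>c\<close> and divided by \<open>sqrt \<rho>\<close>.\<close>

lemma ellipsoid_affine_isomorphic_ball:
  fixes V :: "'a::euclidean_space set"
  assumes V: "subspace V" and c: "c \<in> V"
    and A: "linear A" "\<And>x y. A x \<bullet> y = x \<bullet> A y" "\<And>x. x \<noteq> 0 \<Longrightarrow> A x \<bullet> x > 0" and \<rho>: "\<rho> > 0"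
  shows "affine_isomorphic {x \<in> V. A (x - c) \<bullet> (x - c) \<le> \<rho>} (cball 0 1 \<inter> V)"
proof -
  obtain f where f: "linear f" "bij_betw f V V" "\<And>x. x \<in> V \<Longrightarrow> (norm (f x))\<^sup>2 = A x \<bullet> x"
    using linear_isometry_of_form[OF A V] by metis
  let ?E = "{x \<in> V. A (x - c) \<bullet> (x - c) \<le> \<rho>}"
  define h where "h x = (1 / sqrt \<rho>) *\<^sub>R f (x - c)" for x
  have norm_h: "norm (h x) \<le> 1 \<longleftrightarrow> x \<in> ?E" if x: "x \<in> V" for x
  proof -
    have "norm (h x) \<le> 1 \<longleftrightarrow> norm (f (x - c)) \<le> sqrt \<rho>" using \<rho> by (simp add: h_def field_simps)
    also have "\<dots> \<longleftrightarrow> (norm (f (x - c)))\<^sup>2 \<le> \<rho>"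
      using \<rho> abs_le_square_iff[of "norm (f (x - c))" "sqrt \<rho>"] by simp
    finally show ?thesis using f(3)[OF subspace_diff[OF V x c]] x by simp
  qed
  have "bij_betw h V V"
  proof (rule bij_betwI')
    have inj: "inj_on f V" and img: "f ` V = V" using f(2) by (auto simp: bij_betw_def)
    show "h x = h y \<longleftrightarrow> x = y" if "x \<in> V" "y \<in> V" for x y
      using inj_on_eq_iff[OF inj, of "x - c" "y - c"] \<rho> that V c by (auto simp: h_def subspace_diff)
    show "h x \<in> V" if "x \<in> V" for x
      unfolding h_def using that V c img by (blast intro: subspace_scale subspace_diff)
    show "\<exists>x\<in>V. y = h x" if "y \<in> V" for y
    proof -
      have "sqrt \<rho> *\<^sub>R y \<in> f ` V" using img that V by (simp add: subspace_scale)
      then obtain z where "z \<in> V" "sqrt \<rho> *\<^sub>R y = f z" by (rule imageE)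
      then show ?thesis using V c \<rho>
        by (intro bexI[of _ "z + c"])
          (auto simp: h_def subspace_add simp flip: \<open>sqrt \<rho> *\<^sub>R y = f z\<close>)
    qed
  qed
  then have inj: "inj_on h V" and img: "h ` V = V" by (auto simp: bij_betw_def)
  have "?E = {x \<in> V. norm (h x) \<le> 1}" using norm_h by blast
  then have "h ` ?E = {y \<in> h ` V. norm y \<le> 1}" by auto
  then have "h ` ?E = cball 0 1 \<inter> V" unfolding img by auto
  with inj have "bij_betw h ?E (cball 0 1 \<inter> V)"
    unfolding bij_betw_def by (auto intro: inj_on_subset)
  moreover have "affine_on ?E h"
    unfolding affine_on_def
  proof (intro ballI allI impI)
    fix x y and u v :: real
    assume "u + v = 1"
    then have "u *\<^sub>R x + v *\<^sub>R y - c = u *\<^sub>R (x - c) + v *\<^sub>R (y - c)"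
      by (simp add: algebra_simps flip: scaleR_left_distrib)
    then show "h (u *\<^sub>R x + v *\<^sub>R y) = u *\<^sub>R h x + v *\<^sub>R h y"
      by (simp add: h_def linear_add[OF f(1)] linear_cmul[OF f(1)] scaleR_add_right)
  qed
  ultimately show ?thesis by (auto simp: affine_isomorphic_def)
qed

subsection \<open>The unit ball\<close>

lemma extreme_point_affine_image:
  assumes S: "convex S" and f: "affine_on S f" "bij_betw f S T" and x: "x extreme_point_of S"
  shows "f x extreme_point_of T"
  unfolding extreme_point_of_def
proof (intro conjI ballI notI)
  have xS: "x \<in> S" using x by (simp add: extreme_point_of_def)
  then show "f x \<in> T" using f(2) by (auto simp: bij_betw_def)
  fix a b assume ab: "a \<in> T" "b \<in> T" "f x \<in> open_segment a b"
  then obtain u where u: "a \<noteq> b" "0 < u" "u < 1" "f x = (1 - u) *\<^sub>R a + u *\<^sub>R b"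
    by (auto simp: in_segment)
  obtain a' b' where ab': "a' \<in> S" "b' \<in> S" "a = f a'" "b = f b'"
    using ab f(2) by (auto simp: bij_betw_def)
  have "f x = f ((1 - u) *\<^sub>R a' + u *\<^sub>R b')"
    using affine_onD[OF f(1) ab'(1,2), of "1 - u" u] u ab' by simp
  moreover have "(1 - u) *\<^sub>R a' + u *\<^sub>R b' \<in> S" using convexD[OF S ab'(1,2)] u by simp
  ultimately have "x = (1 - u) *\<^sub>R a' + u *\<^sub>R b'" using f(2) xS
    by (auto simp: bij_betw_def dest: inj_onD)
  then have "x \<in> open_segment a' b'" using u ab' by (auto simp: in_segment)
  then show False using x ab' by (auto simp: extreme_point_of_def)
qed

lemma distinguishable_pairs_affine_image:
  assumes S: "convex S" and f: "affine_on S f" "bij_betw f S T"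
    and st: "(s, t) \<in> distinguishable_pairs S"
  shows "(f s, f t) \<in> distinguishable_pairs T"
proof -
  let ?h = "inv_into S f"
  obtain e :: "'a \<Rightarrow> real" where s: "s \<in> extreme_points S" "t \<in> extreme_points S" "s \<in> S" "t \<in> S"
    and e: "affine_on S e" "\<And>x. x \<in> S \<Longrightarrow> 0 \<le> e x \<and> e x \<le> 1" "e s = 1" "e t = 0"
    using st by (auto simp: distinguishable_pairs_def distinguishable_pair_iff)
  have h: "?h y \<in> S" if "y \<in> T" for y
    using that f(2) by (auto simp: bij_betw_def inv_into_into)
  have hf: "?h (f x) = x" if "x \<in> S" for x using that f(2) by (simp add: bij_betw_inv_into_left)
  have "affine_on T (e \<circ> ?h)"
    using affine_on_compose[OF affine_on_inv_into[OF S f] _ e(1)] h by blast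
  moreover have "f s \<in> T" "f t \<in> T" using s f(2) by (auto simp: bij_betw_def)
  ultimately show ?thesis
    using s e h hf extreme_point_affine_image[OF S f]
    by (auto simp: distinguishable_pairs_def distinguishable_pair_iff extreme_points_def
      intro!: exI[of _ "e \<circ> ?h"])
qed

text \<open>An extreme point is its own decomposition, since the constant functional 1 distinguishes
  a single point.\<close>

lemma spectrality_2I:
  assumes "\<And>x. x \<in> S \<Longrightarrow> x extreme_point_of S \<or> (\<exists>s t u. (s, t) \<in> distinguishable_pairs S \<and>
    0 \<le> u \<and> u \<le> 1 \<and> x = (1 - u) *\<^sub>R s + u *\<^sub>R t)"
  shows "spectrality 2 S"
  unfolding spectrality_def
proof
  fix x assume x: "x \<in> S"
  show "\<exists>xs. \<exists>c :: nat \<Rightarrow> real. 1 \<le> length xs \<and> length xs \<le> 2 \<and>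
      set xs \<subseteq> extreme_points S \<and> distinguishable S xs \<and>
      (\<forall>j<length xs. c j \<ge> 0) \<and> (\<Sum>j<length xs. c j) = 1 \<and>
      x = (\<Sum>j<length xs. c j *\<^sub>R (xs ! j))"
    using assms[OF x]
  proof (elim disjE exE conjE)
    assume "x extreme_point_of S"
    moreover have "distinguishable S [x]" using x
      by (auto simp: distinguishable_def affine_on_def intro!: exI[of _ "\<lambda>_ _. 1"])
    ultimately show ?thesis
      by (intro exI[of _ "[x]"] exI[of _ "\<lambda>_. 1"]) (simp add: extreme_points_def)
  next
    fix s t u assume "(s, t) \<in> distinguishable_pairs S" "0 \<le> u" "u \<le> 1"
      "x = (1 - u) *\<^sub>R s + u *\<^sub>R t"
    then show ?thesis
      by (intro exI[of _ "[s, t]"] exI[of _ "\<lambda>j. if j = 0 then 1 - u else u"])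
        (auto simp: distinguishable_pairs_def lessThan_Suc add.commute)
  qed
qed

section \<open>Distinguishable pairs and symmetries of the unit ball\<close>

text \<open>A functional separating \<open>s\<close> from \<open>t\<close> takes the value 1 at
  \<open>s\<close> and at \<open>- t\<close>, hence at their midpoint, which must then have norm 1;
  this forces \<open>t = - s\<close>. Conversely \<open>(1 + s \<bullet> x) / 2\<close> separates
  \<open>s\<close> from \<open>- s\<close>.\<close>

lemma distinguishable_pairs_unit_ball:
  fixes V :: "'a::euclidean_space set"
  assumes V: "subspace V"
  shows "distinguishable_pairs (cball 0 1 \<inter> V) = {(s, - s) |s. s \<in> V \<and> norm s = 1}"
    (is "?P = ?R")
proof (rule subset_antisym; rule subsetI)
  let ?T = "cball 0 1 \<inter> V"
  fix p assume "p \<in> ?P"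
  then obtain s t where p: "p = (s, t)" "(s, t) \<in> ?P" by (cases p) auto
  then obtain e :: "'a \<Rightarrow> real" where st: "s \<in> ?T" "t \<in> ?T"
    and e: "affine_on ?T e" "\<And>x. x \<in> ?T \<Longrightarrow> 0 \<le> e x \<and> e x \<le> 1" "e s = 1" "e t = 0"
    unfolding distinguishable_pairs_def distinguishable_pair_iff by blast
  have neg: "- x \<in> ?T" if "x \<in> ?T" for x using that V by (auto simp: subspace_neg)
  have zero: "0 \<in> ?T" using V by (auto simp: subspace_0)
  have e_neg: "e x + e (- x) = 2 * e 0" if "x \<in> ?T" for x
    using affine_onD[OF e(1) that neg[OF that], of "1/2" "1/2"] by simp
  \<comment> \<open>By symmetry about 0, the value 1 at \<open>s\<close> gives
    \<open>e 0 \<ge> 1/2\<close>, and the value 0 at \<open>t\<close> gives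
    \<open>e 0 \<le> 1/2\<close>.\<close>
  have e0: "e 0 = 1/2"
    using e_neg[OF st(1)] e_neg[OF st(2)] e(2)[OF neg[OF st(1)]] e(2)[OF neg[OF st(2)]] e(3,4) by linarith
  let ?m = "(1/2) *\<^sub>R s + (1/2) *\<^sub>R (- t)"
  have mV: "?m \<in> V" using st V
    by (auto intro!: subspace_add subspace_scale subspace_diff subspace_neg)
  have "norm ?m \<le> norm ((1/2) *\<^sub>R s) + norm ((1/2) *\<^sub>R (- t))" by (rule norm_triangle_ineq)
  also have "\<dots> \<le> 1" using st by simp
  finally have m: "?m \<in> ?T" using mV by simp
  have "e (- t) = 1" using e_neg[OF st(2)] e0 e(4) by simp
  then have em: "e ?m = 1"
    using affine_onD[OF e(1) st(1) neg[OF st(2)], of "1/2" "1/2"] e(3) by simp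
  then have m0: "norm ?m > 0" using e0 by auto
  \<comment> \<open>A shorter midpoint could be stretched to norm 1, where \<open>e\<close> would
    exceed 1, since it grows along the ray from its value 1/2 at 0.\<close>
  have "norm ?m \<ge> 1"
  proof (rule ccontr)
    assume less: "\<not> norm ?m \<ge> 1"
    define k where "k = norm ?m"
    have k: "0 < k" "k < 1" using less m0 by (auto simp: k_def)
    let ?y = "(1 / k) *\<^sub>R ?m"
    have y: "?y \<in> ?T" using mV V k by (auto simp: k_def intro!: subspace_scale)
    have "e ?m = k * e ?y + (1 - k) * e 0"
      using affine_onD[OF e(1) y zero, of k "1 - k"] k by simp
    moreover have "k * e ?y \<le> k * 1" using e(2)[OF y] k by (intro mult_left_mono) auto
    ultimately have "1 \<le> k * 1 + (1 - k) * (1/2)" unfolding em e0 by (metis add_right_mono)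
    then show False using k by (simp add: field_simps)
  qed
  then have "norm (s - t) \<ge> 2" by (simp add: algebra_simps flip: scaleR_diff_right)
  then have "(norm (s - t))\<^sup>2 \<ge> 2\<^sup>2" by (intro power_mono) auto
  moreover have n1: "(norm s)\<^sup>2 \<le> 1" "(norm t)\<^sup>2 \<le> 1" using st by (auto simp: power_le_one)
  \<comment> \<open>The parallelogram law leaves no room for \<open>s + t\<close> once
    \<open>norm (s - t) \<ge> 2\<close>.\<close>
  moreover have "(norm (s - t))\<^sup>2 + (norm (s + t))\<^sup>2 = 2 * (norm s)\<^sup>2 + 2 * (norm t)\<^sup>2"
    by (simp add: power2_norm_eq_inner inner_simps inner_commute)
  ultimately have "(norm (s + t))\<^sup>2 \<le> 0" "1 \<le> (norm s)\<^sup>2"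
    using zero_le_power2[of "norm (s + t)"] by (simp_all only: power2_eq_square[of "2::real"])
  then have "s + t = 0" "norm s \<ge> 1" by (auto simp: power2_eq_1_iff intro: power2_le_imp_le)
  moreover have "norm s \<le> 1" "s \<in> V" using st by auto
  ultimately show "p \<in> ?R" using p(1) by (auto simp: add_eq_0_iff)
next
  let ?T = "cball 0 1 \<inter> V"
  fix p assume "p \<in> ?R"
  then obtain s where p: "p = (s, - s)" and s: "s \<in> V" "norm s = 1" by blast
  have ext: "x extreme_point_of ?T" if x: "x \<in> V" "norm x = 1" for x
    unfolding extreme_point_of_def
  proof (intro conjI ballI notI)
    show "x \<in> ?T" using x by simp
    fix a b assume ab: "a \<in> ?T" "b \<in> ?T" "x \<in> open_segment a b"
    then obtain u where u: "a \<noteq> b" "0 < u" "u < 1" "x = (1 - u) *\<^sub>R a + u *\<^sub>R b"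
      by (auto simp: in_segment)
    have le: "x \<bullet> y \<le> 1" if "y \<in> ?T" for y
      using norm_cauchy_schwarz[of x y] x(2) that by simp
    have xx: "x \<bullet> x = 1" using x(2) by (simp add: norm_eq_1)
    have "x \<bullet> x = (1 - u) * (x \<bullet> a) + u * (x \<bullet> b)"
      by (subst (2) u(4)) (simp add: inner_simps)
    \<comment> \<open>A proper convex combination of two numbers at most 1 equals 1, so both are 1;
      the equality case of Cauchy-Schwarz then identifies both endpoints with
      \<open>x\<close>.\<close>
    then have "(1 - u) * (1 - x \<bullet> a) + u * (1 - x \<bullet> b) = 0" using xx by (simp add: algebra_simps)
    moreover have "(1 - u) * (1 - x \<bullet> a) \<ge> 0" "u * (1 - x \<bullet> b) \<ge> 0" using le ab u by auto
    ultimately have "(1 - u) * (1 - x \<bullet> a) = 0" "u * (1 - x \<bullet> b) = 0" by linarith+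
    then have "x \<bullet> a = 1" "x \<bullet> b = 1" using u by auto
    moreover have "y = x" if "y \<in> ?T" "x \<bullet> y = 1" for y
    proof -
      have "(norm y)\<^sup>2 \<le> 1" using that by (simp add: power_le_one)
      then have "(norm (y - x))\<^sup>2 \<le> 0"
        using that xx by (simp add: power2_norm_eq_inner inner_simps inner_commute)
      then show ?thesis by simp
    qed
    ultimately show False using ab u(1) by metis
  qed
  have "affine_on ?T (\<lambda>x. (1 + s \<bullet> x) / 2)"
    unfolding affine_on_def
  proof (intro ballI allI impI)
    fix x y :: 'a and u v :: real assume "u + v = 1"
    then have v: "v = 1 - u" by simp
    show "(1 + s \<bullet> (u *\<^sub>R x + v *\<^sub>R y)) / 2 = u *\<^sub>R ((1 + s \<bullet> x) / 2) + v *\<^sub>R ((1 + s \<bullet> y) / 2)"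
      unfolding v by (simp add: inner_simps field_simps)
  qed
  moreover have "0 \<le> (1 + s \<bullet> x) / 2 \<and> (1 + s \<bullet> x) / 2 \<le> 1" if "x \<in> ?T" for x
    using Cauchy_Schwarz_ineq2[of s x] s(2) that by (auto simp: abs_le_iff)
  moreover have "- s \<in> V" using s(1) V by (simp add: subspace_neg)
  moreover have "s \<bullet> s = 1" using s(2) by (simp add: norm_eq_1)
  ultimately show "p \<in> ?P" using s ext[of s] ext[of "- s"] p
    by (auto simp: distinguishable_pairs_def distinguishable_pair_iff extreme_points_def
        intro!: exI[of _ "\<lambda>x. (1 + s \<bullet> x) / 2"])
qed

text \<open>For \<open>s \<noteq> t\<close>, the Householder reflection in the hyperplane orthogonal
  to \<open>s - t\<close>. Linearity is recorded because it also yields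
  \<open>g (- s) = - t\<close>, as the action on pairs demands.\<close>

lemma unit_ball_reflection:
  fixes V :: "'a::euclidean_space set"
  assumes V: "subspace V" and s: "s \<in> V" "norm s = 1" and t: "t \<in> V" "norm t = 1"
  obtains g where "linear g" "automorphism (cball 0 1 \<inter> V) g" "g s = t"
proof (cases "s = t")
  case True
  have "automorphism (cball 0 1 \<inter> V) (\<lambda>x::'a. x)"
    by (auto simp: automorphism_def affine_on_def bij_betw_def)
  then show thesis using that[of "\<lambda>x. x"] True linear_ident by blast
next
  case False
  define d where "d = s - t"
  have d: "d \<in> V" "d \<bullet> d \<noteq> 0" using False s t V by (auto simp: d_def subspace_diff)
  define g where "g x = x - (2 * (d \<bullet> x) / (d \<bullet> d)) *\<^sub>R d" for x
  have lin: "linear g"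
    by (intro linearI) (auto simp: g_def inner_simps algebra_simps add_divide_distrib)
  have gg: "g (g x) = x" for x
    using d(2) by (simp add: g_def inner_simps field_simps)
  have "g x \<bullet> g x = x \<bullet> x" for x
    using d(2) by (simp add: g_def inner_simps inner_commute field_simps)
  then have norm_g: "norm (g x) = norm x" for x by (simp add: norm_eq_sqrt_inner)
  have "g x \<in> V" if "x \<in> V" for x
    unfolding g_def using that V d(1) by (intro subspace_diff subspace_scale)
  then have maps: "g x \<in> cball 0 1 \<inter> V" if "x \<in> cball 0 1 \<inter> V" for x
    using that norm_g by simp
  have "bij_betw g (cball 0 1 \<inter> V) (cball 0 1 \<inter> V)"
    by (rule bij_betwI[where g = g]) (use maps gg in auto)
  then have "automorphism (cball 0 1 \<inter> V) g"
    by (simp add: automorphism_def affine_on_def linear_add[OF lin] linear_cmul[OF lin])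
  moreover have "g s = t"
  proof -
    have "s \<bullet> s = 1" "t \<bullet> t = 1" using s t by (auto simp: norm_eq_1)
    then have "2 * (d \<bullet> s) = d \<bullet> d" by (simp add: d_def inner_simps inner_commute)
    then show ?thesis using d(2) by (simp add: g_def d_def)
  qed
  ultimately show thesis using lin that by blast
qed

lemma spectrality_2_unit_ball:
  fixes V :: "'a::euclidean_space set"
  assumes V: "subspace V"
  shows "spectrality 2 (cball 0 1 \<inter> V)"
proof (rule spectrality_2I)
  let ?T = "cball 0 1 \<inter> V"
  fix x assume x: "x \<in> ?T"
  show "x extreme_point_of ?T \<or> (\<exists>s t u. (s, t) \<in> distinguishable_pairs ?T \<and>
    0 \<le> u \<and> u \<le> 1 \<and> x = (1 - u) *\<^sub>R s + u *\<^sub>R t)"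
  proof (cases "V \<subseteq> {0}")
    \<comment> \<open>There is no unit vector here, and the only point is extreme.\<close>
    case True
    then have "?T = {0}" using subspace_0[OF V] by auto
    then show ?thesis using x by simp
  next
    case False
    then obtain y where y: "y \<in> V" "y \<noteq> 0" by blast
    \<comment> \<open>The direction of the diameter through \<open>x\<close>; at the centre any unit
      vector of \<open>V\<close> serves.\<close>
    obtain s where s: "s \<in> V" "norm s = 1" "x = norm x *\<^sub>R s"
    proof (cases "x = 0")
      case True
      then show thesis using that[of "sgn y"] y V
        by (simp add: norm_sgn sgn_div_norm subspace_scale)
    next
      case False
      then show thesis using that[of "sgn x"] x V
        by (simp add: norm_sgn sgn_div_norm subspace_scale)
    qed
    define u where "u = (1 - norm x) / 2"
    have "(1 - u) *\<^sub>R s + u *\<^sub>R (- s) = ((1 - u) + - u) *\<^sub>R s"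
      by (simp only: scaleR_left_distrib) simp
    also have "(1 - u) + - u = norm x" by (simp add: u_def field_simps)
    finally have "x = (1 - u) *\<^sub>R s + u *\<^sub>R (- s)" using s(3) by simp
    moreover have "0 \<le> u" "u \<le> 1" using x by (auto simp: u_def field_simps)
    moreover have "(s, - s) \<in> distinguishable_pairs ?T"
      unfolding distinguishable_pairs_unit_ball[OF V] using s by blast
    ultimately show ?thesis by blast
  qed
qed

text \<open>Both conditions hold in the ball and are carried back along \<open>f\<close>:
  decompositions by its inverse, automorphisms by conjugation.\<close>

lemma affine_isomorphic_unit_ball_imp:
  fixes S V :: "'a::euclidean_space set"
  assumes S: "convex S" and V: "subspace V" and iso: "affine_isomorphic S (cball 0 1 \<inter> V)"
  shows "spectrality 2 S"
    "\<lbrakk>(s1, s2) \<in> distinguishable_pairs S; (t1, t2) \<in> distinguishable_pairs S\<rbrakk>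
      \<Longrightarrow> \<exists>g. automorphism S g \<and> g s1 = t1 \<and> g s2 = t2"
proof -
  let ?T = "cball 0 1 \<inter> V"
  obtain f where f: "affine_on S f" "bij_betw f S ?T"
    using iso by (auto simp: affine_isomorphic_def)
  define h where "h = inv_into S f"
  have h: "affine_on ?T h" "bij_betw h ?T S"
    unfolding h_def using affine_on_inv_into[OF S f] bij_betw_inv_into[OF f(2)] by auto
  have hf: "h (f x) = x" if "x \<in> S" for x
    unfolding h_def using that f(2) by (simp add: bij_betw_inv_into_left)
  have fT: "f x \<in> ?T" if "x \<in> S" for x using that f(2) by (auto simp: bij_betw_def)
  have T: "convex ?T" using V by (intro convex_Int convex_cball subspace_imp_convex)
  show "spectrality 2 S"
  proof (rule spectrality_2I)
    fix x assume x: "x \<in> S"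
    show "x extreme_point_of S \<or> (\<exists>s t u. (s, t) \<in> distinguishable_pairs S \<and>
      0 \<le> u \<and> u \<le> 1 \<and> x = (1 - u) *\<^sub>R s + u *\<^sub>R t)"
    proof (cases "f x extreme_point_of ?T")
      case True
      then show ?thesis using extreme_point_affine_image[OF T h True] hf[OF x] by simp
    next
      case False
      then obtain s t u where st: "(s, t) \<in> distinguishable_pairs ?T" and u: "0 \<le> u" "u \<le> 1"
        "f x = (1 - u) *\<^sub>R s + u *\<^sub>R t"
        using spectrality_2_cases[OF spectrality_2_unit_ball[OF V] fT[OF x]] by metis
      have "s \<in> ?T" "t \<in> ?T" using st distinguishable_pairs_subset by blast+
      then have "x = (1 - u) *\<^sub>R h s + u *\<^sub>R h t"
        using affine_onD[OF h(1), of s t "1 - u" u] u hf[OF x] by simp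
      then show ?thesis using distinguishable_pairs_affine_image[OF T h st] u by blast
    qed
  qed
  assume st: "(s1, s2) \<in> distinguishable_pairs S" "(t1, t2) \<in> distinguishable_pairs S"
  have "s1 \<in> S" "s2 \<in> S" "t1 \<in> S" "t2 \<in> S" using st distinguishable_pairs_subset by blast+
  note hf = this[THEN hf]
  have "(f s1, f s2) \<in> distinguishable_pairs ?T" "(f t1, f t2) \<in> distinguishable_pairs ?T"
    using distinguishable_pairs_affine_image[OF S f] st by blast+
  then have s: "f s1 \<in> V" "norm (f s1) = 1" "f s2 = - f s1" and t: "f t1 \<in> V" "norm (f t1) = 1"
    "f t2 = - f t1"
    unfolding distinguishable_pairs_unit_ball[OF V] by auto
  obtain g where g: "linear g" "automorphism ?T g" "g (f s1) = f t1"
    using unit_ball_reflection[OF V s(1,2) t(1,2)] by metis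
  have "affine_on S (h \<circ> (g \<circ> f))"
    using g(2) fT automorphismD(3)[OF g(2)]
    by (intro affine_on_compose[where T = ?T] f(1) h(1)) (auto intro: automorphismD(1))
  moreover have "bij_betw (h \<circ> (g \<circ> f)) S S"
    using bij_betw_trans[OF bij_betw_trans[OF f(2) automorphismD(2)[OF g(2)]] h(2)]
      by (simp add: comp_assoc)
  moreover have "g (f s2) = f t2" using g(3) s(3) t(3) linear_neg[OF g(1), of "f s1"] by simp
  ultimately show "\<exists>g. automorphism S g \<and> g s1 = t1 \<and> g s2 = t2"
    using g(3) hf by (intro exI[of _ "h \<circ> (g \<circ> f)"]) (simp add: automorphism_def)
qed

text \<open>The affine hull is modelled as an \<open>n\<close>-dimensional linear subspace
  \<open>V\<close> of a Euclidean space, so the \<open>n\<close>-dimensional unit ball is the unit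
  ball of \<open>V\<close>.\<close>

theorem theorem5:
  fixes S V :: "'a::euclidean_space set" and n :: nat
  assumes "subspace V" and "dim V = n"
    and "compact S" and "convex S" and "affine hull S = V"
  shows "affine_isomorphic S (cball 0 1 \<inter> V) \<longleftrightarrow>
    transitive_action (AffGroup S) (distinguishable_pairs S) (diagonal_action S) \<and>
    spectrality 2 S"
proof
  assume "affine_isomorphic S (cball 0 1 \<inter> V)"
  from affine_isomorphic_unit_ball_imp[OF assms(4,1) this]
  show "transitive_action (AffGroup S) (distinguishable_pairs S) (diagonal_action S) \<and> spectrality 2 S"
    unfolding transitive_action_diagonal_iff[OF assms(4)] automorphism_def by blast
next
  assume *: "transitive_action (AffGroup S) (distinguishable_pairs S) (diagonal_action S) \<and> spectrality 2 S"
  then have spec: "spectrality 2 S" by blast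
  have transitive: "\<exists>g. automorphism S g \<and> g s1 = t1 \<and> g s2 = t2"
    if "(s1, s2) \<in> distinguishable_pairs S" "(t1, t2) \<in> distinguishable_pairs S" for s1 s2 t1 t2
    using conjunct1[OF *, unfolded transitive_action_diagonal_iff[OF assms(4)]] that
    unfolding automorphism_def by fastforce
  \<comment> \<open>The affine hull contains 0, whereas the empty set has empty hull.\<close>
  have "S \<noteq> {}" using assms(5) subspace_0[OF assms(1)] by auto
  then obtain c where c: "c \<in> rel_interior S" and fixed: "\<And>g. automorphism S g \<Longrightarrow> g c = c"
    using automorphisms_common_fixed_point[OF assms(3,4)] by blast
  have cS: "c \<in> S" using c rel_interior_subset by blast
  show "affine_isomorphic S (cball 0 1 \<inter> V)"
  proof (cases "S \<subseteq> {c}")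
    \<comment> \<open>A single point has no distinguishable pairs to supply a radius, so the
      zero-dimensional ball is matched directly.\<close>
    case True
    then have "S = {c}" using cS by auto
    moreover from this have "V = {0}" using assms(5) subspace_0[OF assms(1)] by auto
    ultimately have "S = {0}" "V = {0}" using assms(5) by auto
    then have "affine_on S (\<lambda>x. x)" "bij_betw (\<lambda>x. x) S (cball 0 1 \<inter> V)"
      by (auto simp: affine_on_def bij_betw_def)
    then show ?thesis unfolding affine_isomorphic_def by blast
  next
    case False
    obtain A :: "'a \<Rightarrow> 'a" and \<rho> :: real where A: "linear A" "\<And>x y. A x \<bullet> y = x \<bullet> A y"
      "\<And>x. x \<noteq> 0 \<Longrightarrow> A x \<bullet> x > 0" "\<rho> > 0"
      and eq: "S = {x \<in> V. A (x - c) \<bullet> (x - c) \<le> \<rho>}"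
      using spectral_transitive_imp_ellipsoid[OF assms(3,4) False c _ _ spec] fixed transitive
      unfolding assms(5) by blast
    have "c \<in> V" using cS assms(5) hull_inc by metis
    then show ?thesis
      using ellipsoid_affine_isomorphic_ball[OF assms(1) _ A] eq by simp
  qed
qed

end
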